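(* Let $T$ be a tree (of order greater than $2$) with eccentric sequence $S=(r;m_2,m_3,\ldots,m_l)$. (a) Let $g:\mathbb{N}\to\mathbb{R}$ be nonnegative and nondecreasing. Then $$W(T;g)\geq W(\mathbf{T}(r;m_2,m_3,\ldots,m_l);g).$$ If, in addition, $g$ is strictly increasing, then equality holds if and only if $T=\mathbf{T}(r;m_2,\ldots,m_l)$. (b) Let $g:\mathbb{N}\to\mathbb{R}$ be nonnegative and nonincreasing. Then $$W(T;g)\leq W(\mathbf{T}(r;m_2,m_3,\ldots,m_l);g).$$ If, in addition, $g$ is strictly decreasing, then equality holds if and only if $T=\mathbf{T}(r;m_2,\ldots,m_l)$.
   Context: Graphs are finite and simple; $\mathbb{N}$ is the set of positive integers; $d(u,v)$ is the usual graph distance. For trees, $T_1=T_2$ means that $T_1$ and $T_2$ are isomorphic. The eccentricity of a vertex $v$ is $\max_u d(v,u)$. The eccentric sequence of a connected graph is the nondecreasing sequence of the eccentricities of its vertices. Only trees with $n>2$ vertices are considered. For a tree, let $b_1<b_2<\cdots<b_l$ be the distinct eccentricities of its vertices and let $m_j$ be the number of vertices of eccentricity $b_j$. The $b_j$ are consecutive integers, $m_1\in\{1,2\}$, and the eccentric sequence is completely determined by $b_1,m_2,\ldots,m_l$; it is written $S=(b_1;m_2,m_3,\ldots,m_l)$. So "eccentric sequence $S=(r;m_2,\ldots,m_l)$" means that $b_1=r$ is the radius, the eccentricities that occur are exactly $r,r+1,\ldots,r+l-1$, exactly $m_j$ vertices have eccentricity $r+j-1$ for $2\le j\le l$, and the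 diameter is $r+l-1$. For integers $b_1>0$ and $m_2,\ldots,m_l>1$, $\mathbf{T}(b_1;m_2,\ldots,m_l)$ is the tree obtained from the path $v_0,v_1,\ldots,v_{b_1+l-1}$ by attaching $m_j-2$ pendent edges to the vertex $v_{l+1-j}$ for all $2\le j\le l$. For a connected graph $G$ and $g:\mathbb{N}\to\mathbb{R}$, $W(G;g)=\sum_{\{u,v\}\subseteq V(G),\,u\ne v} g(d(u,v))$, the sum over all unordered pairs of distinct vertices. *)

theory Defs
  imports Complex_Main "Graph_Theory.Graph_Theory"
begin

text \<open>
  A finite simple graph is a \<^locale>\<open>pair_graph\<close>: a finite, loop-free, symmetric digraph without
  parallel arcs, each undirected edge being represented by its two arcs. In such a digraph the
  closed walk a, b, a counts as a \<^const>\<open>pre_digraph.cycle\<close>, so \<^const>\<open>tree\<close> from the library does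
  not express the undirected notion. The cycles of the undirected graph are those of length at
  least 3.
\<close>

definition simple_tree :: "'a pair_pre_digraph \<Rightarrow> bool" where
  "simple_tree G \<longleftrightarrow> pair_graph G \<and> connected (with_proj G) \<and>
     \<not> (\<exists>p. pre_digraph.cycle (with_proj G) p \<and> 3 \<le> length p)"

text \<open>Distances are only meaningful for vertices joined by a walk.\<close>

definition gdist :: "'a pair_pre_digraph \<Rightarrow> 'a \<Rightarrow> 'a \<Rightarrow> nat" where
  "gdist G u v = (LEAST k. \<exists>p. pre_digraph.awalk (with_proj G) u p v \<and> length p = k)"

definition ecc :: "'a pair_pre_digraph \<Rightarrow> 'a \<Rightarrow> nat" where
  "ecc G v = Max (gdist G v ` pverts G)"

text \<open>
  The eccentric sequence of \<open>G\<close> is \<open>(r; m 2, \<dots>, m l)\<close>. Only the values \<open>m j\<close> with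
  \<open>2 \<le> j \<le> l\<close> matter.
\<close>

definition has_eccentric_sequence :: "'a pair_pre_digraph \<Rightarrow> nat \<Rightarrow> nat \<Rightarrow> (nat \<Rightarrow> nat) \<Rightarrow> bool" where
  "has_eccentric_sequence G r l m \<longleftrightarrow>
     ecc G ` pverts G = {r..<r + l} \<and>
     (\<forall>j\<in>{2..l}. card {v \<in> pverts G. ecc G v = r + j - 1} = m j)"

text \<open>
  \<open>Path i\<close> is the vertex \<open>v\<^sub>i\<close> of the path, and \<open>Pendent j k\<close> is the end of the \<open>k\<close>-th pendent edge
  attached on behalf of \<open>m j\<close>, i.e.\ at \<open>v\<^bsub>l+1-j\<^esub>\<close>. The construction is meant for \<open>r > 0\<close> and
  \<open>m j > 1\<close>, where none of the subtractions is truncated.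
\<close>

datatype cat_vertex = Path nat | Pendent nat nat

definition ecc_caterpillar :: "nat \<Rightarrow> nat \<Rightarrow> (nat \<Rightarrow> nat) \<Rightarrow> cat_vertex pair_pre_digraph" where
  "ecc_caterpillar r l m =
     (let E = {(Path i, Path (i + 1)) | i. i < r + l - 1} \<union>
              {(Path (l + 1 - j), Pendent j k) | j k. j \<in> {2..l} \<and> k < m j - 2}
      in \<lparr> pverts = {Path i | i. i \<le> r + l - 1} \<union>
                    {Pendent j k | j k. j \<in> {2..l} \<and> k < m j - 2},
           parcs = E \<union> E\<inverse> \<rparr>)"

text \<open>The distance between the two members of an unordered pair.\<close>

definition pair_dist :: "'a pair_pre_digraph \<Rightarrow> 'a set \<Rightarrow> nat" where
  "pair_dist G e = (THE d. \<exists>u v. e = {u, v} \<and> d = gdist G u v)"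

text \<open>
  The value of \<open>g\<close> at 0 never enters, so \<open>g\<close> stands for a function on the positive integers.
\<close>

definition gen_wiener :: "'a pair_pre_digraph \<Rightarrow> (nat \<Rightarrow> real) \<Rightarrow> real" where
  "gen_wiener G g = (\<Sum>e\<in>{e. e \<subseteq> pverts G \<and> card e = 2}. g (pair_dist G e))"

lemma (in pair_graph) gdist_commute: "gdist G u v = gdist G v u"
proof -
  have "\<exists>q. awalk y q x \<and> length q = length p" if "awalk x p y" for x y p
  proof (intro exI conjI)
    show "awalk y (rev_path p) x" using that by simp
    show "length (rev_path p) = length p" by (induct p) auto
  qed
  then have "(\<exists>p. awalk u p v \<and> length p = k) \<longleftrightarrow> (\<exists>p. awalk v p u \<and> length p = k)" for k
    by metis
  then show ?thesis by (simp add: gdist_def)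
qed

lemma (in pair_graph) pair_dist_eq: "pair_dist G {u, v} = gdist G u v"
  unfolding pair_dist_def
proof (rule the_equality)
  show "\<exists>u' v'. {u, v} = {u', v'} \<and> gdist G u v = gdist G u' v'" by blast
next
  fix d assume "\<exists>u' v'. {u, v} = {u', v'} \<and> d = gdist G u' v'"
  then show "d = gdist G u v" by (metis doubleton_eq_iff gdist_commute)
qed

lemma pair_graph_ecc_caterpillar:
  assumes "r > 0"
  shows "pair_graph (ecc_caterpillar r l m)"
proof -
  let ?V = "pverts (ecc_caterpillar r l m)" and ?A = "parcs (ecc_caterpillar r l m)"
  have V: "?V = Path ` {..r + l - 1} \<union> (\<lambda>(j, k). Pendent j k) ` (SIGMA j:{2..l}. {..<m j - 2})"
    by (auto simp: ecc_caterpillar_def Let_def)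
  have fin: "finite ?V" unfolding V by blast
  have A: "e \<in> ?A \<Longrightarrow> fst e \<in> ?V \<and> snd e \<in> ?V \<and> fst e \<noteq> snd e" for e
    using assms by (auto simp: ecc_caterpillar_def Let_def)
  have "?A \<subseteq> ?V \<times> ?V" using A by force
  then have finA: "finite ?A" using fin by (meson finite_SigmaI finite_subset)
  have sym: "sym ?A" by (auto simp: ecc_caterpillar_def Let_def sym_def)
  show ?thesis
    using A fin finA sym by unfold_locales (auto simp: symmetric_def)
qed

end

theory Submission
  imports Defs
begin

text \<open>
  Let \<open>s + t + 1\<close> with \<open>t \<le> s \<le> t + 1\<close> be the diameter of the tree. The middle edge \<open>ab\<close> of a longest
  path cuts the tree into a side of depth \<open>s\<close> hanging from \<open>a\<close> and a side of depth \<open>t\<close> hanging from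
  \<open>b\<close>. Put \<open>e = s - t\<close> and let the level of a vertex be its distance from \<open>a\<close>, or \<open>e\<close> plus its
  distance from \<open>b\<close>, according to its side. Then the eccentricity of a vertex is \<open>t + 1\<close> plus its
  level (\<open>eccentricity_depth\<close>), so \<open>r = t + 1\<close>, \<open>l = s + 1\<close>, and the eccentric sequence prescribes how
  many vertices each level has.

  Distances between levels \<open>i \<le> j\<close> are almost determined. Every vertex of level \<open>j\<close> has exactly one
  ancestor on level \<open>i\<close>, at distance \<open>j - i\<close>. Every other vertex of level \<open>i\<close> on the same side is, by
  parity, at distance at least \<open>j - i + 2\<close>, and every one on the other side is at distance exactly
  \<open>i + j + 1 - e\<close>. If the two sides have \<open>a\<^sub>i\<close> and \<open>b\<^sub>i\<close> vertices on level \<open>i\<close>, the number of pairs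
  that cross the middle edge is
  \<open>a\<^sub>i b\<^sub>j + b\<^sub>i a\<^sub>j = (a\<^sub>i + b\<^sub>i) + (a\<^sub>j + b\<^sub>j) - 2 + (a\<^sub>i - 1) (b\<^sub>j - 1) + (b\<^sub>i - 1) (a\<^sub>j - 1)\<close>,
  hence smallest when one side is a path. This makes twice the Wiener sum equal to a quantity that
  depends on the level sizes only, plus an excess that is nonnegative for nondecreasing \<open>g\<close>
  (\<open>total_sum\<close>, \<open>excess_nonneg\<close>). The caterpillar has excess zero, which is the inequality.

  For strictly increasing \<open>g\<close>, excess zero has two consequences. On levels deeper than \<open>e\<close> there is no
  surplus of crossing pairs, and so one side is a path if the middle edge is chosen suitably
  (\<open>balanced_edge_with_path_side\<close>). Unrelated vertices of the other side are as close as possible,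
  which puts all vertices with a child on one path (\<open>tight_imp_caterpillar_shape\<close>). A tree of this
  shape is determined by its level sizes (\<open>caterpillar_shape_unique\<close>).

  Nonincreasing \<open>g\<close> are covered by passing to \<open>-g\<close>.
\<close>


section \<open>Distances in trees\<close>

text \<open>
  The part of the theory of trees that concerns only the metric: adjacency is distance 1, every
  vertex has a unique neighbour closer to any given target, and all its other neighbours are farther
  away.
\<close>

locale tree_metric =
  fixes V :: "'v set" and d :: "'v \<Rightarrow> 'v \<Rightarrow> nat"
  assumes finite_V: "finite V"
    and d_0_iff: "\<And>x y. \<lbrakk>x \<in> V; y \<in> V\<rbrakk> \<Longrightarrow> d x y = 0 \<longleftrightarrow> x = y"
    and d_sym: "\<And>x y. d x y = d y x"
    and step_ex: "\<And>x y. \<lbrakk>x \<in> V; y \<in> V; x \<noteq> y\<rbrakk> \<Longrightarrow> \<exists>z\<in>V. d x z = 1 \<and> d x y = Suc (d z y)"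
    and step_unique: "\<And>x y z z'. \<lbrakk>x \<in> V; y \<in> V; z \<in> V; z' \<in> V; d x z = 1; d x z' = 1;
        d x y = Suc (d z y); d x y = Suc (d z' y)\<rbrakk> \<Longrightarrow> z = z'"
    and adjacent_dist: "\<And>x y z. \<lbrakk>x \<in> V; y \<in> V; z \<in> V; d x y = 1\<rbrakk> \<Longrightarrow> d x z = Suc (d y z) \<or> d y z = Suc (d x z)"
begin

lemma triangle: "\<lbrakk>x \<in> V; y \<in> V; z \<in> V\<rbrakk> \<Longrightarrow> d x z \<le> d x y + d y z"
proof (induction "d x y" arbitrary: x)
  case 0
  then show ?case using d_0_iff by fastforce
next
  case (Suc n)
  then have "x \<noteq> y" using d_0_iff by fastforce
  then obtain x' where x': "x' \<in> V" "d x x' = 1" "d x y = Suc (d x' y)"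
    using step_ex Suc.prems by blast
  then have "d x' z \<le> d x' y + d y z" using Suc by simp
  moreover have "d x z \<le> Suc (d x' z)" using adjacent_dist[OF Suc.prems(1) x'(1) Suc.prems(3) x'(2)] by auto
  ultimately show ?case using x' by simp
qed

text \<open>
  A tree is bipartite: a step changes both distances \<open>d x y\<close> and \<open>d x z\<close> by one.
\<close>

lemma parity: "\<lbrakk>x \<in> V; y \<in> V; z \<in> V\<rbrakk> \<Longrightarrow> even (d x y + d x z + d y z)"
proof (induction "d x y" arbitrary: x)
  case 0
  then have "x = y" "d x y = 0" using d_0_iff by simp_all
  then show ?case by simp
next
  case (Suc n)
  then have "x \<noteq> y" using d_0_iff by fastforce
  then obtain x' where x': "x' \<in> V" "d x x' = 1" "d x y = Suc (d x' y)"
    using step_ex Suc.prems by blast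
  then have "even (d x' y + d x' z + d y z)" using Suc by simp
  then show ?case using adjacent_dist[OF Suc.prems(1) x'(1) Suc.prems(3) x'(2)] x'(3) by auto
qed

lemma geodesic_ex:
  "\<lbrakk>x \<in> V; y \<in> V; k \<le> d x y\<rbrakk> \<Longrightarrow> \<exists>z\<in>V. d x z = k \<and> d x y = k + d z y"
proof (induction k)
  case 0
  then show ?case using d_0_iff by force
next
  case (Suc k)
  then obtain z where z: "z \<in> V" "d x z = k" "d x y = k + d z y" by (meson Suc_leD)
  then have "z \<noteq> y" using Suc.prems by auto
  then obtain z' where z': "z' \<in> V" "d z z' = 1" "d z y = Suc (d z' y)"
    using step_ex Suc.prems z by blast
  have "d x z' \<le> Suc k" using triangle[of x z z'] Suc.prems z z' by simp
  moreover have "d x y \<le> d x z' + d z' y" using triangle Suc.prems z' by simp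
  ultimately show ?case using z z' by (intro bexI[of _ z']) auto
qed

lemma geodesic_unique:
  "\<lbrakk>x \<in> V; y \<in> V; z \<in> V; z' \<in> V; d x z = d x z'; d x y = d x z + d z y; d x y = d x z' + d z' y\<rbrakk> \<Longrightarrow> z = z'"
proof (induction "d x z" arbitrary: x)
  case 0
  then show ?case by (metis d_0_iff)
next
  case (Suc k)
  have ne: "x \<noteq> z" "x \<noteq> z'" using Suc d_0_iff by (metis Zero_not_Suc)+
  obtain w where w: "w \<in> V" "d x w = 1" "d x z = Suc (d w z)" using step_ex ne Suc.prems by blast
  obtain w' where w': "w' \<in> V" "d x w' = 1" "d x z' = Suc (d w' z')" using step_ex ne Suc.prems by blast
  have *: "d x y = Suc (d w y)" "d w y = d w z + d z y"
    if "w \<in> V" "d x w = 1" "d x z = Suc (d w z)" "z \<in> V" "d x y = d x z + d z y" for w z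
    using triangle[of w z y] triangle[of x w y] that Suc.prems by auto
  have "w = w'" using step_unique *(1) w w' Suc.prems by blast
  then show ?case using Suc.hyps(1)[of w] Suc.hyps(2) Suc.prems w w' *(2) by (metis nat.inject)
qed

definition side :: "'v \<Rightarrow> 'v \<Rightarrow> 'v set" where
  "side a b = {x \<in> V. d x a < d x b}"

context
  fixes a b
  assumes ab: "a \<in> V" "b \<in> V" "d a b = 1"
begin

lemma side_far: "x \<in> side a b \<Longrightarrow> d x b = Suc (d x a)"
  using adjacent_dist[of a b x] ab by (auto simp: side_def d_sym)

lemma side_compl: "V - side b a = side a b"
proof -
  have "d x a < d x b \<longleftrightarrow> \<not> d x b < d x a" if "x \<in> V" for x
    using adjacent_dist[OF ab(1,2) that ab(3)] d_sym[of x] by auto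
  then show ?thesis by (auto simp: side_def)
qed

text \<open>
  A path between the two sides of an edge \<open>ab\<close> passes through that edge. The induction moves \<open>x\<close>
  towards \<open>a\<close>: by uniqueness of steps, moving back cannot be a step towards \<open>y\<close>.
\<close>

lemma dist_across:
  assumes y: "y \<in> side b a"
  shows "x \<in> side a b \<Longrightarrow> d x y = d x a + 1 + d b y"
proof (induction "d x a" arbitrary: x rule: less_induct)
  case less
  have V: "x \<in> V" "y \<in> V" using less y by (auto simp: side_def)
  have ya: "d a y = Suc (d b y)"
    using adjacent_dist[of a b y] ab y by (auto simp: side_def d_sym)
  show ?case
  proof (cases "x = a")
    case True
    then show ?thesis using ya ab d_0_iff by auto
  next
    case False
    obtain x1 where x1: "x1 \<in> V" "d x x1 = 1" "d x a = Suc (d x1 a)" using step_ex False V ab by blast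
    have x1b: "x1 \<in> side a b"
      using adjacent_dist[of x x1 b] side_far[OF less.prems] ab x1 V by (auto simp: side_def)
    have x1y: "d x1 y = d x1 a + 1 + d b y" using less.hyps[of x1] x1b x1 by simp
    (* The step from x1 towards y leads away from x, so x is not the step towards y. *)
    obtain x2 where x2: "x2 \<in> V" "d x1 x2 = 1" "d x1 y = Suc (d x2 y)" "x2 \<noteq> x"
    proof (cases "x1 = a")
      case True
      have "x \<noteq> b" using less.prems ab d_0_iff[of b b] by (auto simp: side_def)
      then show ?thesis using that[of b] ya ab True by simp
    next
      case False
      obtain x2 where x2: "x2 \<in> V" "d x1 x2 = 1" "d x1 a = Suc (d x2 a)" using step_ex False ab x1 by blast
      have "x2 \<in> side a b"
        using adjacent_dist[of x1 x2 b] side_far[OF x1b] ab x1 x2 by (auto simp: side_def)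
      then have "d x2 y = d x2 a + 1 + d b y" using less.hyps[of x2] x1 x2 by simp
      moreover have "x2 \<noteq> x" using x1 x2 by auto
      ultimately show ?thesis using that[of x2] x1y x2 by simp
    qed
    have "d x1 y \<noteq> Suc (d x y)" using step_unique[of x1 y x x2] x1 x2 V by (auto simp: d_sym)
    then have "d x y = Suc (d x1 y)" using adjacent_dist[of x x1 y] x1 V by auto
    then show ?thesis using x1y x1 by simp
  qed
qed

end

text \<open>
  A middle edge of a longest path, described by the depths of its two sides.
\<close>

definition balanced_edge :: "'v \<Rightarrow> 'v \<Rightarrow> nat \<Rightarrow> nat \<Rightarrow> bool" where
  "balanced_edge a b s t \<longleftrightarrow> a \<in> V \<and> b \<in> V \<and> d a b = 1 \<and> t \<le> s \<and> s \<le> Suc t \<and>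
     (\<forall>x\<in>side a b. d x a \<le> s) \<and> (\<exists>x\<in>side a b. d x a = s) \<and>
     (\<forall>y\<in>side b a. d y b \<le> t) \<and> (\<exists>y\<in>side b a. d y b = t)"

lemma balanced_edge_exists:
  assumes "1 < card V"
  shows "\<exists>a b s t. balanced_edge a b s t"
proof -
  define D where "D = Max (case_prod d ` (V \<times> V))"
  have ne: "V \<noteq> {}" using assms by auto
  have fin: "finite (case_prod d ` (V \<times> V))" using finite_V by simp
  have D: "d x y \<le> D" if "x \<in> V" "y \<in> V" for x y
    unfolding D_def using fin that by (intro Max_ge) auto
  have "D \<in> case_prod d ` (V \<times> V)"
    unfolding D_def using fin ne by (intro Max_in) auto
  then obtain u w where uw: "u \<in> V" "w \<in> V" "d u w = D" by auto
  obtain x y where xy: "x \<in> V" "y \<in> V" "x \<noteq> y"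
    using assms by (metis card_le_Suc0_iff_eq finite_V not_le One_nat_def)
  have D0: "D > 0" using D[OF xy(1,2)] d_0_iff[OF xy(1,2)] xy(3) by simp
  define s t where "s = D div 2" and "t = D - 1 - s"
  have st: "D = s + 1 + t" "t \<le> s" "s \<le> Suc t" using D0 unfolding s_def t_def by auto
  (* The middle edge of a longest path from u to w; a side deeper than its half of the path would
     give a longer one. *)
  obtain a where a: "a \<in> V" "d u a = s" "d u w = s + d a w"
    using geodesic_ex[of u w s] uw st by auto
  have "a \<noteq> w" using a uw st d_0_iff by auto
  then obtain b where b: "b \<in> V" "d a b = 1" "d a w = Suc (d b w)" using step_ex a uw by blast
  have ub: "d u b = Suc s" 
    using triangle[of u a b] triangle[of u b w] a b uw by simp
  have u: "u \<in> side a b" using ub a uw by (simp add: side_def)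
  have w: "w \<in> side b a" using b uw by (simp add: side_def d_sym)
  have bw: "d b w = t" using a b uw st by simp
  have ba: "d b a = 1" using b d_sym by simp
  have "d x a \<le> s" if "x \<in> side a b" for x
    using dist_across[OF a(1) b(1,2) w that] D[of x w] that uw bw st by (auto simp: side_def)
  moreover have "d y b \<le> t" if "y \<in> side b a" for y
    using dist_across[OF b(1) a(1) ba u that] D[of y u] that uw st a d_sym by (auto simp: side_def)
  moreover have "d u a = s" "d w b = t" using a bw d_sym by auto
  ultimately have "balanced_edge a b s t"
    unfolding balanced_edge_def using a b st u w by blast
  then show ?thesis by blast
qed

end

section \<open>Sums over level pairs\<close>

definition gap :: "nat \<Rightarrow> nat \<Rightarrow> nat" where "gap i j = max i j - min i j"

lemma gap_commute: "gap i j = gap j i" by (simp add: gap_def max.commute min.commute)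

lemma gap_le: "i \<le> j \<Longrightarrow> gap i j = j - i" by (simp add: gap_def)

text \<open>
  What a pair of levels \<open>i\<close>, \<open>j\<close> of sizes \<open>M i\<close>, \<open>M j\<close> contributes when as few pairs as possible
  cross the middle edge and all unrelated pairs of one side are as close as possible. The three terms
  belong to related pairs, crossing pairs and the remaining ones.
\<close>

definition profile :: "nat \<Rightarrow> (nat \<Rightarrow> real) \<Rightarrow> (nat \<Rightarrow> real) \<Rightarrow> nat \<Rightarrow> nat \<Rightarrow> real" where
  "profile e M h i j =
    (if i < e \<or> j < e then M (max i j) * h (gap i j)
     else M (max i j) * h (gap i j) + (M i + M j - 2) * h (i + j + 1 - e)
       + (M i * M j - M (max i j) - (M i + M j - 2)) * h (gap i j + 2))"

text \<open>
  A rooted forest of one or two trees, seen through its distances only: \<open>R\<close> is one side of the middle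
  edge, and \<open>s\<close> is the deepest level. For \<open>e = 0\<close> both ends of the edge are on level 0; for \<open>e = 1\<close> the
  centre is the only vertex on level 0, and \<open>R\<close> starts on level 1.
\<close>

locale two_sided =
  fixes V :: "'v set" and d :: "'v \<Rightarrow> 'v \<Rightarrow> nat" and lev :: "'v \<Rightarrow> nat" and R :: "'v set"
    and s e :: nat
  assumes finite_V: "finite V"
    and R_sub: "R \<subseteq> V"
    and d_sym: "\<And>x y. d x y = d y x"
    and e_le_1: "e \<le> 1"
    and lev_le: "\<And>x. x \<in> V \<Longrightarrow> lev x \<le> s"
    and lev_R: "\<And>y. y \<in> R \<Longrightarrow> e \<le> lev y"
    and ancestor: "\<And>y i. \<lbrakk>y \<in> V; i \<le> lev y\<rbrakk> \<Longrightarrow> \<exists>!x. x \<in> V \<and> lev x = i \<and> d x y = lev y - i"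
    and low: "\<And>x y. \<lbrakk>x \<in> V; y \<in> V; lev x < e\<rbrakk> \<Longrightarrow> d x y = gap (lev x) (lev y)"
    and across: "\<And>x y. \<lbrakk>x \<in> V - R; y \<in> R; e \<le> lev x\<rbrakk> \<Longrightarrow> d x y = lev x + lev y + 1 - e"
    and same_side: "\<And>x y. \<lbrakk>x \<in> V; y \<in> V; x \<in> R \<longleftrightarrow> y \<in> R; d x y \<noteq> gap (lev x) (lev y)\<rbrakk>
          \<Longrightarrow> gap (lev x) (lev y) + 2 \<le> d x y"
    and root_unique: "\<And>x y. \<lbrakk>x \<in> V; y \<in> V; lev x = 0; lev y = 0; x \<in> R \<longleftrightarrow> y \<in> R\<rbrakk> \<Longrightarrow> x = y"
    and left_ex: "\<And>i. i \<le> s \<Longrightarrow> \<exists>x\<in>V - R. lev x = i"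
    and right_ex: "\<And>i. \<lbrakk>e \<le> i; i \<le> s\<rbrakk> \<Longrightarrow> \<exists>x\<in>R. lev x = i"
begin

definition level :: "nat \<Rightarrow> 'v set" where "level i = {x \<in> V. lev x = i}"
definition left_level :: "nat \<Rightarrow> 'v set" where "left_level i = {x \<in> V - R. lev x = i}"
definition right_level :: "nat \<Rightarrow> 'v set" where "right_level i = {x \<in> R. lev x = i}"

abbreviation size :: "nat \<Rightarrow> real" where "size i \<equiv> real (card (level i))"
abbreviation left :: "nat \<Rightarrow> real" where "left i \<equiv> real (card (left_level i))"
abbreviation right :: "nat \<Rightarrow> real" where "right i \<equiv> real (card (right_level i))"

definition unrelated_same_side :: "nat \<Rightarrow> nat \<Rightarrow> ('v \<times> 'v) set" where
  "unrelated_same_side i j =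
     {(x, y). x \<in> level i \<and> y \<in> level j \<and> (x \<in> R \<longleftrightarrow> y \<in> R) \<and> d x y \<noteq> gap i j}"

text \<open>
  The first summand measures how many more pairs than necessary cross the middle edge, the second how
  much farther than necessary the unrelated pairs of one side are apart. The only vertex on a level
  less than \<open>e\<close> is the centre, from which all distances are determined by the level.
\<close>

definition excess :: "(nat \<Rightarrow> real) \<Rightarrow> nat \<Rightarrow> nat \<Rightarrow> real" where
  "excess h i j = (if i < e \<or> j < e then 0 else
     ((left i - 1) * (right j - 1) + (right i - 1) * (left j - 1)) * (h (i + j + 1 - e) - h (gap i j + 2))
     + (\<Sum>(x, y)\<in>unrelated_same_side i j. h (d x y) - h (gap i j + 2)))"

lemma finite_level[simp]: "finite (level i)" "finite (left_level i)" "finite (right_level i)"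
  using finite_V finite_subset[OF R_sub] by (auto simp: level_def left_level_def right_level_def)

lemma size_eq: "size i = left i + right i"
proof -
  have "level i = left_level i \<union> right_level i" "left_level i \<inter> right_level i = {}"
    using R_sub by (auto simp: level_def left_level_def right_level_def)
  then show ?thesis by (simp add: card_Un_disjoint)
qed

text \<open>
  Of two levels, each vertex of the deeper one has exactly one relative on the other.
\<close>

lemma card_related: "card {(x, y). x \<in> level i \<and> y \<in> level j \<and> d x y = gap i j} = card (level (max i j))"
proof -
  have *: "card {(x, y). x \<in> level i \<and> y \<in> level j \<and> d x y = gap i j} = card (level j)" if "i \<le> j" for i j
  proof -
    have "\<exists>x. {x \<in> level i. d x y = gap i j} = {x}" if y: "y \<in> level j" for y
    proof -
      have "\<exists>!x. x \<in> V \<and> lev x = i \<and> d x y = j - i"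
        using ancestor[of y i] y \<open>i \<le> j\<close> by (auto simp: level_def)
      then obtain x where "\<forall>z. (z \<in> V \<and> lev z = i \<and> d z y = j - i) \<longleftrightarrow> z = x" by (auto simp: Ex1_def)
      then show ?thesis using gap_le[OF \<open>i \<le> j\<close>] by (auto simp: level_def)
    qed
    then have one: "card {x \<in> level i. d x y = gap i j} = 1" if "y \<in> level j" for y
      using that by fastforce
    have "card (SIGMA y:level j. {x \<in> level i. d x y = gap i j}) = (\<Sum>y\<in>level j. 1)"
      using one by (subst card_SigmaI) auto
    moreover have "bij_betw prod.swap (SIGMA y:level j. {x \<in> level i. d x y = gap i j})
        {(x, y). x \<in> level i \<and> y \<in> level j \<and> d x y = gap i j}"
      by (rule bij_betwI[where g = prod.swap]) auto
    ultimately show ?thesis by (simp add: bij_betw_same_card)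
  qed
  show ?thesis
  proof (cases "i \<le> j")
    case True
    then show ?thesis using * by (simp add: max_def)
  next
    case False
    have "bij_betw prod.swap {(x, y). x \<in> level i \<and> y \<in> level j \<and> d x y = gap i j}
        {(x, y). x \<in> level j \<and> y \<in> level i \<and> d x y = gap j i}"
      by (rule bij_betwI[where g = prod.swap]) (auto simp: gap_commute d_sym)
    then show ?thesis using *[of j i] False by (simp add: bij_betw_same_card max_def)
  qed
qed

text \<open>
  The related and the crossing pairs have known distances and known numbers, which leaves the number
  of unrelated pairs on a common side as the rest. Moving the surplus of crossing pairs into the excess
  rests on \<open>a\<^sub>i b\<^sub>j + b\<^sub>i a\<^sub>j = m\<^sub>i + m\<^sub>j - 2 + (a\<^sub>i - 1) (b\<^sub>j - 1) + (b\<^sub>i - 1) (a\<^sub>j - 1)\<close>.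
\<close>

lemma level_pair_sum:
  assumes "i \<le> s" "j \<le> s"
  shows "(\<Sum>x\<in>level i. \<Sum>y\<in>level j. h (d x y)) = profile e size h i j + excess h i j"
proof -
  define Rel where "Rel = {(x, y). x \<in> level i \<and> y \<in> level j \<and> d x y = gap i j}"
  define Cross where "Cross = left_level i \<times> right_level j \<union> right_level i \<times> left_level j"
  let ?Same = "unrelated_same_side i j" and ?All = "level i \<times> level j"
  have all: "(\<Sum>x\<in>level i. \<Sum>y\<in>level j. h (d x y)) = (\<Sum>(x, y)\<in>?All. h (d x y))"
    by (simp add: sum.cartesian_product)
  have Rel_sum: "(\<Sum>(x, y)\<in>Rel. h (d x y)) = size (max i j) * h (gap i j)"
  proof -
    have "(\<Sum>(x, y)\<in>Rel. h (d x y)) = (\<Sum>p\<in>Rel. h (gap i j))"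
      by (intro sum.cong) (auto simp: Rel_def)
    then show ?thesis using card_related by (simp add: Rel_def)
  qed
  show ?thesis
  proof (cases "i < e \<or> j < e")
    case True
    have "d x y = gap i j" if "x \<in> level i" "y \<in> level j" for x y
      using True low[of x y] low[of y x] that gap_commute d_sym by (auto simp: level_def)
    then have "?All = Rel" by (auto simp: Rel_def)
    then show ?thesis using True all Rel_sum by (simp add: profile_def excess_def)
  next
    case False
    have "Rel \<subseteq> ?All" "Cross \<subseteq> ?All" "?Same \<subseteq> ?All"
      using R_sub
      by (auto simp: Rel_def Cross_def unrelated_same_side_def left_level_def right_level_def level_def)
    then have fin: "finite Rel" "finite Cross" "finite ?Same"
      using finite_subset[of _ ?All] by simp_all
    have cross_d: "d x y = i + j + 1 - e" if "(x, y) \<in> Cross" for x y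
      using that False across[of x y] across[of y x] d_sym[of x y]
      by (auto simp: Cross_def left_level_def right_level_def add.commute)
    have cross_gap: "i + j + 1 - e \<noteq> gap i j" using False e_le_1 by (auto simp: gap_def max_def min_def)
    have disj: "Rel \<inter> Cross = {}" "(Rel \<union> Cross) \<inter> ?Same = {}"
      using cross_d cross_gap
      by (auto simp: Rel_def unrelated_same_side_def) (auto simp: Cross_def left_level_def right_level_def)
    have un: "?All = Rel \<union> Cross \<union> ?Same"
      using R_sub by (auto simp: Rel_def unrelated_same_side_def Cross_def left_level_def right_level_def level_def)
    define C where "C = left i * right j + right i * left j"
    have card_Cross: "real (card Cross) = C"
    proof -
      have "left_level i \<times> right_level j \<inter> right_level i \<times> left_level j = {}"
        by (auto simp: left_level_def right_level_def)
      then show ?thesis unfolding Cross_def C_def by (simp add: card_Un_disjoint card_cartesian_product)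
    qed
    have Cross_sum: "(\<Sum>(x, y)\<in>Cross. h (d x y)) = C * h (i + j + 1 - e)"
    proof -
      have "(\<Sum>(x, y)\<in>Cross. h (d x y)) = (\<Sum>p\<in>Cross. h (i + j + 1 - e))"
        using cross_d by (intro sum.cong) auto
      then show ?thesis using card_Cross by simp
    qed
    have "card ?All = card Rel + card Cross + card ?Same"
      unfolding un using fin disj by (simp add: card_Un_disjoint)
    then have "size i * size j = size (max i j) + C + real (card ?Same)"
      using card_related[of i j] card_Cross by (simp add: Rel_def card_cartesian_product flip: of_nat_mult of_nat_add)
    then have card_Same: "real (card ?Same) = size i * size j - size (max i j) - C" by simp
    have Same_sum: "(\<Sum>(x, y)\<in>?Same. h (d x y)) =
        (\<Sum>(x, y)\<in>?Same. h (d x y) - h (gap i j + 2)) + real (card ?Same) * h (gap i j + 2)"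
      by (simp add: case_prod_unfold sum_subtractf)
    have "(\<Sum>(x, y)\<in>?All. h (d x y)) =
        (\<Sum>(x, y)\<in>Rel. h (d x y)) + (\<Sum>(x, y)\<in>Cross. h (d x y)) + (\<Sum>(x, y)\<in>?Same. h (d x y))"
      unfolding un using fin disj by (simp add: sum.union_disjoint)
    then show ?thesis
      unfolding all Rel_sum Cross_sum Same_sum card_Same
      using False by (simp add: profile_def excess_def C_def size_eq algebra_simps)
  qed
qed

lemma sum_by_levels:
  fixes f :: "'v \<Rightarrow> real"
  shows "(\<Sum>x\<in>V. f x) = (\<Sum>i\<le>s. \<Sum>x\<in>level i. f x)"
proof -
  have "(\<Sum>i\<le>s. sum f {x \<in> V. lev x = i}) = sum f V"
    by (rule sum.group) (use finite_V lev_le in auto)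
  then show ?thesis by (simp add: level_def)
qed

lemma total_sum:
  "(\<Sum>x\<in>V. \<Sum>y\<in>V. h (d x y)) = (\<Sum>i\<le>s. \<Sum>j\<le>s. profile e size h i j) + (\<Sum>i\<le>s. \<Sum>j\<le>s. excess h i j)"
proof -
  have "(\<Sum>x\<in>V. \<Sum>y\<in>V. h (d x y)) = (\<Sum>i\<le>s. \<Sum>x\<in>level i. \<Sum>j\<le>s. \<Sum>y\<in>level j. h (d x y))"
    by (simp add: sum_by_levels)
  also have "\<dots> = (\<Sum>i\<le>s. \<Sum>j\<le>s. \<Sum>x\<in>level i. \<Sum>y\<in>level j. h (d x y))"
    by (intro sum.cong refl sum.swap)
  also have "\<dots> = (\<Sum>i\<le>s. \<Sum>j\<le>s. profile e size h i j + excess h i j)"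
    by (intro sum.cong refl level_pair_sum) auto
  finally show ?thesis by (simp add: sum.distrib)
qed

lemma left_ge_1: "i \<le> s \<Longrightarrow> 1 \<le> left i"
proof -
  assume "i \<le> s"
  then have "left_level i \<noteq> {}" using left_ex by (force simp: left_level_def)
  then have "0 < card (left_level i)" by (simp add: card_gt_0_iff)
  then show ?thesis by simp
qed

lemma right_ge_1: "\<lbrakk>e \<le> i; i \<le> s\<rbrakk> \<Longrightarrow> 1 \<le> right i"
proof -
  assume "e \<le> i" "i \<le> s"
  then have "right_level i \<noteq> {}" using right_ex by (force simp: right_level_def)
  then have "0 < card (right_level i)" by (simp add: card_gt_0_iff)
  then show ?thesis by simp
qed

lemma left_0: "left 0 = 1"
proof -
  obtain x where "x \<in> V - R" "lev x = 0" using left_ex[of 0] by auto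
  then have "left_level 0 = {x}" using root_unique[of _ x] by (auto simp: left_level_def)
  then show ?thesis by simp
qed

lemma right_0: "e = 0 \<Longrightarrow> right 0 = 1"
proof -
  assume "e = 0"
  then obtain x where "x \<in> R" "lev x = 0" using right_ex[of 0] by auto
  then have "right_level 0 = {x}" using root_unique[of _ x] R_sub by (auto simp: right_level_def)
  then show ?thesis by simp
qed

lemma right_0': "0 < e \<Longrightarrow> right 0 = 0"
proof -
  assume "0 < e"
  then have "right_level 0 = {}" using lev_R by (force simp: right_level_def)
  then show ?thesis by simp
qed

lemma size_0: "size 0 = 2 - real e"
  using size_eq[of 0] left_0 right_0 right_0' e_le_1 by (cases "e = 0") auto

lemma excess_parts_nonneg:
  fixes h :: "nat \<Rightarrow> real"
  assumes h: "mono_on {1..} h" and "e \<le> i" "e \<le> j" "i \<le> s" "j \<le> s"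
  shows "0 \<le> ((left i - 1) * (right j - 1) + (right i - 1) * (left j - 1)) * (h (i + j + 1 - e) - h (gap i j + 2))"
    and "(x, y) \<in> unrelated_same_side i j \<Longrightarrow> 0 \<le> h (d x y) - h (gap i j + 2)"
proof -
  note mono = mono_onD[OF h]
  show "0 \<le> ((left i - 1) * (right j - 1) + (right i - 1) * (left j - 1)) * (h (i + j + 1 - e) - h (gap i j + 2))"
  proof (cases "i = 0 \<or> j = 0")
    case True
    (* Level 0 is the only one on which the crossing distance can fall short of gap + 2, and
       there each side has a single vertex. *)
    then have "e = 0" using assms by auto
    then show ?thesis using True left_0 right_0 by auto
  next
    case False
    then have "gap i j + 2 \<le> i + j + 1 - e" using e_le_1 by (auto simp: gap_def max_def min_def)
    then have "0 \<le> h (i + j + 1 - e) - h (gap i j + 2)" using mono[of "gap i j + 2" "i + j + 1 - e"] by simp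
    then show ?thesis using left_ge_1 right_ge_1 assms by (intro mult_nonneg_nonneg add_nonneg_nonneg) auto
  qed
  show "0 \<le> h (d x y) - h (gap i j + 2)" if "(x, y) \<in> unrelated_same_side i j"
    using that same_side[of x y] mono[of "gap i j + 2" "d x y"]
    by (auto simp: unrelated_same_side_def level_def)
qed

lemma excess_nonneg:
  fixes h :: "nat \<Rightarrow> real"
  assumes "mono_on {1..} h" "i \<le> s" "j \<le> s"
  shows "0 \<le> excess h i j"
  using excess_parts_nonneg[OF assms(1)] assms(2,3)
  unfolding excess_def by (auto intro!: add_nonneg_nonneg sum_nonneg)

text \<open>
  Every unrelated pair on a common side attains the lower bound given by parity.
\<close>

definition tight :: bool where
  "tight \<longleftrightarrow> (\<forall>x\<in>V. \<forall>y\<in>V. (x \<in> R \<longleftrightarrow> y \<in> R) \<longrightarrow> d x y = gap (lev x) (lev y) \<or> d x y = gap (lev x) (lev y) + 2)"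

lemma excess_0:
  assumes tight and "inj_on lev R" and "i \<le> s" "j \<le> s"
  shows "excess h i j = 0"
proof (cases "i < e \<or> j < e")
  case False
  have "right k = 1" if "e \<le> k" "k \<le> s" for k
  proof -
    obtain x where "x \<in> R" "lev x = k" using right_ex \<open>e \<le> k\<close> \<open>k \<le> s\<close> by blast
    then have "right_level k = {x}" using \<open>inj_on lev R\<close> by (auto simp: right_level_def inj_on_def)
    then show ?thesis by simp
  qed
  moreover have "d x y = gap i j + 2" if "(x, y) \<in> unrelated_same_side i j" for x y
    using that \<open>tight\<close> by (auto simp: tight_def unrelated_same_side_def level_def)
  then have "(\<Sum>(x, y)\<in>unrelated_same_side i j. h (d x y) - h (gap i j + 2)) = 0"
    by (intro sum.neutral) auto
  ultimately show ?thesis using False assms by (simp add: excess_def)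
qed (simp add: excess_def)

text \<open>
  The crossing distance \<open>i + j + 1 - e\<close> exceeds \<open>gap i j + 2\<close> only if both levels are deeper than
  \<open>e\<close>. On the other levels, a surplus of crossing pairs is impossible or costs nothing.
\<close>

lemma excess_0_imp:
  fixes h :: "nat \<Rightarrow> real"
  assumes h: "strict_mono_on {1..} h"
    and sum_0: "(\<Sum>i\<le>s. \<Sum>j\<le>s. excess h i j) = 0"
  shows tight
    and "\<And>i j. \<lbrakk>e < i; e < j; i \<le> s; j \<le> s\<rbrakk> \<Longrightarrow> left i = 1 \<or> right j = 1"
proof -
  note strict = strict_mono_onD[OF h]
  have mono: "mono_on {1..} h" using h by (rule strict_mono_on_imp_mono_on)
  have zero: "excess h i j = 0" if "i \<le> s" "j \<le> s" for i j
  proof -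
    have "(\<Sum>(i, j)\<in>{..s} \<times> {..s}. excess h i j) = 0"
      using sum_0 by (simp add: sum.cartesian_product)
    moreover have "\<And>p. p \<in> {..s} \<times> {..s} \<Longrightarrow> 0 \<le> (case p of (i, j) \<Rightarrow> excess h i j)"
      using excess_nonneg[OF mono] by auto
    ultimately have "\<forall>p\<in>{..s} \<times> {..s}. (case p of (i, j) \<Rightarrow> excess h i j) = 0"
      by (subst (asm) sum_nonneg_eq_0_iff) auto
    then show ?thesis using that by auto
  qed
  have zeros: "((left i - 1) * (right j - 1) + (right i - 1) * (left j - 1)) * (h (i + j + 1 - e) - h (gap i j + 2)) = 0 \<and>
     (\<forall>(x, y)\<in>unrelated_same_side i j. h (d x y) = h (gap i j + 2))"
    if "e \<le> i" "e \<le> j" "i \<le> s" "j \<le> s" for i j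
  proof -
    let ?A = "((left i - 1) * (right j - 1) + (right i - 1) * (left j - 1)) * (h (i + j + 1 - e) - h (gap i j + 2))"
    let ?B = "\<Sum>(x, y)\<in>unrelated_same_side i j. h (d x y) - h (gap i j + 2)"
    have fin: "finite (unrelated_same_side i j)"
      by (rule finite_subset[of _ "level i \<times> level j"]) (auto simp: unrelated_same_side_def)
    have nonneg: "\<And>p. p \<in> unrelated_same_side i j \<Longrightarrow> 0 \<le> (case p of (x, y) \<Rightarrow> h (d x y) - h (gap i j + 2))"
      using excess_parts_nonneg(2)[OF mono that] by auto
    have "?A + ?B = 0" using zero[of i j] that by (simp add: excess_def)
    moreover have "0 \<le> ?A" using excess_parts_nonneg(1)[OF mono that] .
    moreover have "0 \<le> ?B" using nonneg by (rule sum_nonneg)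
    ultimately have "?A = 0" "?B = 0" by linarith+
    moreover have "?B = 0 \<longleftrightarrow> (\<forall>p\<in>unrelated_same_side i j. (case p of (x, y) \<Rightarrow> h (d x y) - h (gap i j + 2)) = 0)"
      by (rule sum_nonneg_eq_0_iff[OF fin nonneg])
    ultimately show ?thesis by auto
  qed
  show tight
    unfolding tight_def
  proof (intro ballI impI)
    fix x y assume xy: "x \<in> V" "y \<in> V" "(x \<in> R) = (y \<in> R)"
    let ?g = "gap (lev x) (lev y)"
    show "d x y = ?g \<or> d x y = ?g + 2"
    proof (rule ccontr)
      assume neg: "\<not> ?thesis"
      then have lt: "?g + 2 < d x y" using same_side[of x y] xy by auto
      have "e \<le> lev x" "e \<le> lev y"
        using low[of x y] low[of y x] neg xy gap_commute d_sym by (auto simp: not_less[symmetric])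
      moreover have "(x, y) \<in> unrelated_same_side (lev x) (lev y)"
        using xy neg by (simp add: unrelated_same_side_def level_def)
      ultimately have "h (d x y) = h (?g + 2)" using zeros lev_le xy by fastforce
      then show False using strict[OF _ _ lt] lt by simp
    qed
  qed
  fix i j assume ij: "e < i" "e < j" "i \<le> s" "j \<le> s"
  have "gap i j + 2 < i + j + 1 - e" using ij e_le_1 by (auto simp: gap_def max_def min_def)
  then have "h (i + j + 1 - e) - h (gap i j + 2) \<noteq> 0" using strict[of "gap i j + 2" "i + j + 1 - e"] by simp
  then have "(left i - 1) * (right j - 1) + (right i - 1) * (left j - 1) = 0" using zeros[of i j] ij by simp
  moreover have "0 \<le> (left i - 1) * (right j - 1)" "0 \<le> (right i - 1) * (left j - 1)"
    using left_ge_1 right_ge_1 ij by simp_all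
  ultimately have "(left i - 1) * (right j - 1) = 0" by linarith
  then show "left i = 1 \<or> right j = 1" by auto
qed

end

section \<open>Levels of a tree\<close>

lemma gap_add_2_le:
  assumes even: "even (n + i + j)" and le: "i \<le> n + j" "j \<le> n + i" and ne: "n \<noteq> gap i j"
  shows "gap i j + 2 \<le> n"
proof (rule ccontr)
  assume neg: "\<not> gap i j + 2 \<le> n"
  show False
  proof (cases "i \<le> j")
    case True
    then have "gap i j = j - i" by (rule gap_le)
    then have "n + i = j + 1" using le ne neg True by linarith
    then have "n + i + j = 2 * j + 1" by linarith
    then have "even (2 * j + 1)" using even by metis
    then show False by simp
  next
    case False
    then have "gap i j = i - j" using gap_le[of j i] by (simp add: gap_commute)
    then have "n + j = i + 1" using le ne neg False by linarith
    then have "n + i + j = 2 * i + 1" by linarith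
    then have "even (2 * i + 1)" using even by metis
    then show False by simp
  qed
qed

context tree_metric
begin

definition eccentricity :: "'v \<Rightarrow> nat" where "eccentricity x = Max (d x ` V)"

text \<open>
  The level of a vertex, defined from its eccentricity so that it does not depend on the choice of the
  middle edge; the radius is \<open>Suc t\<close>.
\<close>

definition depth :: "nat \<Rightarrow> 'v \<Rightarrow> nat" where "depth t x = eccentricity x - Suc t"

lemma balanced_edgeD:
  assumes "balanced_edge a b s t"
  shows "a \<in> V" "b \<in> V" "d a b = 1" "t \<le> s" "s \<le> Suc t"
    "x \<in> side a b \<Longrightarrow> d x a \<le> s" "\<exists>x\<in>side a b. d x a = s"
    "x \<in> side b a \<Longrightarrow> d x b \<le> t" "\<exists>y\<in>side b a. d y b = t"
  using assms by (auto simp: balanced_edge_def)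

context
  fixes a b s t
  assumes bal: "balanced_edge a b s t"
begin

lemmas ab = balanced_edgeD(1-3)[OF bal]

lemma ba: "b \<in> V" "a \<in> V" "d b a = 1"
  using ab d_sym by auto

lemma eccentricity_left:
  assumes x: "x \<in> side a b"
  shows "eccentricity x = Suc t + d x a"
proof -
  obtain w where w: "w \<in> side b a" "d w b = t" using balanced_edgeD(9)[OF bal] by blast
  have far: "d x w = Suc t + d x a" using dist_across[OF ab w(1) x] w d_sym by simp
  have "d x y \<le> Suc t + d x a" if "y \<in> V" for y
  proof (cases "y \<in> side a b")
    case True
    then have "d a y \<le> s" using balanced_edgeD(6)[OF bal] d_sym by metis
    then show ?thesis using triangle[of x a y] x that ab balanced_edgeD(5)[OF bal] by (simp add: side_def)
  next
    case False
    then have y: "y \<in> side b a" using side_compl[OF ba] that by auto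
    then show ?thesis using dist_across[OF ab y x] balanced_edgeD(8)[OF bal y] d_sym[of y b] by simp
  qed
  then show ?thesis
    unfolding eccentricity_def using finite_V far w
    by (intro Max_eqI rev_image_eqI[of w]) (auto simp: side_def)
qed

lemma eccentricity_right:
  assumes x: "x \<in> side b a"
  shows "eccentricity x = Suc s + d x b"
proof -
  obtain w where w: "w \<in> side a b" "d w a = s" using balanced_edgeD(7)[OF bal] by blast
  have far: "d x w = Suc s + d x b" using dist_across[OF ba w(1) x] w d_sym by simp
  have "d x y \<le> Suc s + d x b" if "y \<in> V" for y
  proof (cases "y \<in> side a b")
    case True
    then show ?thesis using dist_across[OF ba True x] balanced_edgeD(6)[OF bal True] d_sym[of y a] by simp
  next
    case False
    then have "y \<in> side b a" using side_compl[OF ba] that by auto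
    then have "d b y \<le> t" using balanced_edgeD(8)[OF bal] d_sym by metis
    then show ?thesis using triangle[of x b y] x that ab balanced_edgeD(4)[OF bal] by (simp add: side_def)
  qed
  then show ?thesis
    unfolding eccentricity_def using finite_V far w
    by (intro Max_eqI rev_image_eqI[of w]) (auto simp: side_def)
qed

lemma depth_left: "x \<in> side a b \<Longrightarrow> depth t x = d x a"
  by (simp add: depth_def eccentricity_left)

lemma depth_right: "x \<in> side b a \<Longrightarrow> depth t x = d x b + (s - t)"
  using balanced_edgeD(4)[OF bal] by (simp add: depth_def eccentricity_right)

text \<open>
  A vertex beyond the edge could not lie on the way from \<open>y\<close> to the near end of the edge.
\<close>

lemma geodesic_stays_left:
  assumes "y \<in> side a b" "z \<in> V" "d y a = d y z + d z a"
  shows "z \<in> side a b"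
proof (rule ccontr)
  assume "z \<notin> side a b"
  then have "z \<in> side b a" using side_compl[OF ba] assms by auto
  then show False using dist_across[OF ab, of z y] assms by simp
qed

lemma geodesic_stays_right:
  assumes "y \<in> side b a" "z \<in> V" "d y b = d y z + d z b"
  shows "z \<in> side b a"
proof (rule ccontr)
  assume "z \<notin> side b a"
  then have "z \<in> side a b" using side_compl[OF ab] assms by auto
  then show False using dist_across[OF ba, of z y] assms by simp
qed

lemma sides_disjoint: "x \<in> side a b \<Longrightarrow> x \<notin> side b a"
  by (auto simp: side_def)

lemma sides_cases:
  assumes "x \<in> V" obtains "x \<in> side a b" | "x \<in> side b a"
  using assms side_compl[OF ab] by auto

lemma eccentricity_depth:
  assumes "x \<in> V"
  shows "eccentricity x = Suc t + depth t x"
  using assms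
proof (cases rule: sides_cases)
  case 1
  then show ?thesis by (simp add: depth_left eccentricity_left)
next
  case 2
  then show ?thesis using balanced_edgeD(4)[OF bal] by (simp add: depth_right eccentricity_right)
qed

text \<open>
  The ancestor is the vertex on the geodesic from \<open>y\<close> to the root \<open>a\<close>. A vertex of the other side
  cannot compete, because its distance to \<open>y\<close> is larger than the difference of the levels.
\<close>

lemma ancestor_left:
  assumes y: "y \<in> side a b" and i: "i \<le> depth t y"
  shows "\<exists>!x. x \<in> V \<and> depth t x = i \<and> d x y = depth t y - i"
proof -
  have yV: "y \<in> V" using y by (auto simp: side_def)
  have dy: "depth t y = d y a" using depth_left y .
  have on_left: "x \<in> side a b" if "x \<in> V" "depth t x = i" "d x y = depth t y - i" for x
  proof (rule ccontr)
    assume "x \<notin> side a b"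
    then have x: "x \<in> side b a" using that sides_cases by blast
    then show False
      using dist_across[OF ba y x] that depth_right[OF x] dy d_sym[of a y] balanced_edgeD(5)[OF bal] i by simp
  qed
  obtain k where k: "depth t y = i + k" using i le_Suc_ex by blast
  obtain z where z: "z \<in> V" "d y z = k" "d y a = k + d z a"
    using geodesic_ex[OF yV ab(1), of k] k dy by auto
  then have zL: "z \<in> side a b" using geodesic_stays_left[OF y z(1)] by presburger
  then have "z \<in> V \<and> depth t z = i \<and> d z y = depth t y - i"
    using z k dy d_sym[of z y] depth_left[OF zL] by (intro conjI; linarith)
  moreover have "x = z" if x: "x \<in> V \<and> depth t x = i \<and> d x y = depth t y - i" for x
  proof -
    have "depth t x = d x a" using x on_left depth_left by blast
    then have "d y x = k" "d y a = k + d x a" using x k dy d_sym[of x y] by linarith+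
    then show ?thesis using geodesic_unique[OF yV ab(1), of x z] x z by presburger
  qed
  ultimately show ?thesis by blast
qed

lemma ancestor_right:
  assumes y: "y \<in> side b a" and i: "i \<le> depth t y"
  shows "\<exists>!x. x \<in> V \<and> depth t x = i \<and> d x y = depth t y - i"
proof -
  have yV: "y \<in> V" using y by (auto simp: side_def)
  have dy: "depth t y = d y b + (s - t)" using depth_right y .
  have e: "s - t \<le> 1" using balanced_edgeD(5)[OF bal] by simp
  show ?thesis
  proof (cases "i < s - t")
    case True
    then have e1: "s - t = 1" "i = 0" using e by auto
    have aL: "a \<in> side a b" using ab d_0_iff by (simp add: side_def)
    have ay: "d a y = depth t y" using dist_across[OF ab y aL] d_sym[of b y] dy e1 ab d_0_iff by simp
    have a0: "depth t a = 0" using depth_left[OF aL] ab d_0_iff by simp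
    have only: "x = a" if "x \<in> V" "depth t x = 0" for x
      using that(1)
    proof (cases rule: sides_cases)
      case 1
      then show ?thesis using depth_left[OF 1] that ab d_0_iff by simp
    next
      case 2
      then show ?thesis using depth_right[OF 2] that e1 by simp
    qed
    show ?thesis
    proof (rule ex1I[of _ a])
      show "a \<in> V \<and> depth t a = i \<and> d a y = depth t y - i" using ay a0 e1(2) ab(1) by simp
      show "x = a" if "x \<in> V \<and> depth t x = i \<and> d x y = depth t y - i" for x
        using only that e1(2) by blast
    qed
  next
    case False
    have on_right: "x \<in> side b a" if "x \<in> V" "depth t x = i" "d x y = depth t y - i" for x
    proof (rule ccontr)
      assume "x \<notin> side b a"
      then have x: "x \<in> side a b" using that sides_cases by blast
      then show False
        using dist_across[OF ab y x] that depth_left[OF x] dy d_sym[of b y] False e i by simp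
    qed
    obtain k where k: "depth t y = i + k" using i le_Suc_ex by blast
    then have "k \<le> d y b" using dy False by linarith
    then obtain z where z: "z \<in> V" "d y z = k" "d y b = k + d z b"
      using geodesic_ex[OF yV ab(2)] by blast
    then have zR: "z \<in> side b a" using geodesic_stays_right[OF y z(1)] by presburger
    then have "z \<in> V \<and> depth t z = i \<and> d z y = depth t y - i"
      using z k dy d_sym[of z y] depth_right[OF zR] by (intro conjI; linarith)
    moreover have "x = z" if x: "x \<in> V \<and> depth t x = i \<and> d x y = depth t y - i" for x
    proof -
      have "depth t x = d x b + (s - t)" using x on_right depth_right by blast
      then have "d y x = k" "d y b = k + d x b" using x k dy d_sym[of x y] by linarith+
      then show ?thesis using geodesic_unique[OF yV ab(2), of x z] x z by presburger
    qed
    ultimately show ?thesis by blast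
  qed
qed

lemma gap_parity:
  assumes "x \<in> V" "y \<in> V" "c \<in> V" "d x y \<noteq> gap (d x c) (d y c)"
  shows "gap (d x c) (d y c) + 2 \<le> d x y"
proof -
  have "even (d x y + d x c + d y c)" using parity assms by simp
  moreover have "d x c \<le> d x y + d y c" "d y c \<le> d x y + d x c"
    using triangle[of x y c] triangle[of y x c] assms d_sym[of x y] by simp_all
  ultimately show ?thesis using assms(4) by (rule gap_add_2_le)
qed

text \<open>
  Cutting a tree at a middle edge yields the situation in which the sums were evaluated.
\<close>

lemma two_sided: "two_sided V d (depth t) (side b a) s (s - t)"
proof
  note B = balanced_edgeD[OF bal]
  show "finite V" by (rule finite_V)
  show "side b a \<subseteq> V" by (auto simp: side_def)
  show "d x y = d y x" for x y by (rule d_sym)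
  show e: "s - t \<le> 1" using B(5) by simp
  show "depth t x \<le> s" if "x \<in> V" for x
    using that
  proof (cases rule: sides_cases)
    case 1
    then show ?thesis using depth_left[OF 1] B(6) by simp
  next
    case 2
    then show ?thesis using depth_right[OF 2] B(4) B(8)[OF 2] by simp
  qed
  show "s - t \<le> depth t y" if "y \<in> side b a" for y using depth_right that by simp
  show "\<exists>!x. x \<in> V \<and> depth t x = i \<and> d x y = depth t y - i" if "y \<in> V" "i \<le> depth t y" for y i
    using that(1) by (cases rule: sides_cases) (use ancestor_left ancestor_right that(2) in blast)+
  show "d x y = gap (depth t x) (depth t y)" if "x \<in> V" "y \<in> V" "depth t x < s - t" for x y
  proof -
    have e1: "s - t = 1" "depth t x = 0" using that e by auto
    have "x \<notin> side b a" using depth_right e1 by auto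
    then have "x \<in> side a b" using that(1) sides_cases by blast
    then have xa: "x = a" "x \<in> side a b" using depth_left e1 d_0_iff that ab by auto
    show ?thesis
    proof (cases rule: sides_cases[OF that(2)])
      case 1
      then show ?thesis using depth_left[OF 1] xa e1 d_sym[of a y] by (simp add: gap_def)
    next
      case 2
      then show ?thesis using depth_right[OF 2] dist_across[OF ab 2 xa(2)] xa e1 d_sym[of b y] d_0_iff that by (simp add: gap_def)
    qed
  qed
  show "d x y = depth t x + depth t y + 1 - (s - t)" if "x \<in> V - side b a" "y \<in> side b a" for x y
    using that side_compl[OF ab] dist_across[OF ab, of y x] depth_left[of x] depth_right[of y] d_sym[of b y] by simp
  show "gap (depth t x) (depth t y) + 2 \<le> d x y"
    if "x \<in> V" "y \<in> V" "(x \<in> side b a) = (y \<in> side b a)" "d x y \<noteq> gap (depth t x) (depth t y)" for x y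
  proof (cases rule: sides_cases[OF that(1)])
    case 1
    then have "y \<in> side a b" using that sides_disjoint sides_cases by blast
    then show ?thesis using gap_parity[of x y a] that 1 depth_left ab by simp
  next
    case 2
    then have y: "y \<in> side b a" using that by blast
    have "gap (depth t x) (depth t y) = gap (d x b) (d y b)"
      using depth_right[OF 2] depth_right[OF y] by (auto simp: gap_def max_def min_def)
    then show ?thesis using gap_parity[of x y b] that ab by simp
  qed
  show "x = y" if "x \<in> V" "y \<in> V" "depth t x = 0" "depth t y = 0" "(x \<in> side b a) = (y \<in> side b a)" for x y
  proof (cases rule: sides_cases[OF that(1)])
    case 1
    then have "y \<in> side a b" using that sides_disjoint sides_cases by blast
    then have "x = a" "y = a" using that 1 depth_left d_0_iff ab by auto
    then show ?thesis by simp
  next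
    case 2
    then have "y \<in> side b a" using that by blast
    then have "x = b" "y = b" using that 2 depth_right d_0_iff ab by auto
    then show ?thesis by simp
  qed
  show "\<exists>x\<in>V - side b a. depth t x = i" if "i \<le> s" for i
  proof -
    obtain u where u: "u \<in> side a b" "d u a = s" using B(7) by blast
    obtain z where z: "z \<in> V" "d u z = s - i" "d u a = (s - i) + d z a"
      using geodesic_ex[of u a "s - i"] u ab by (auto simp: side_def)
    then have "z \<in> side a b" using geodesic_stays_left u by simp
    then show ?thesis using z u that depth_left[of z] sides_disjoint by (intro bexI[of _ z]) auto
  qed
  show "\<exists>x\<in>side b a. depth t x = i" if "s - t \<le> i" "i \<le> s" for i
  proof -
    obtain u where u: "u \<in> side b a" "d u b = t" using B(9) by blast
    have "s - i \<le> t" using that B(4) by linarith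
    then obtain z where z: "z \<in> V" "d u z = s - i" "d u b = (s - i) + d z b"
      using geodesic_ex[of u b "s - i"] u ab by (auto simp: side_def)
    then have zR: "z \<in> side b a" using geodesic_stays_right u by simp
    then have "depth t z = i" using z u that depth_right[of z] B(4) by auto
    then show ?thesis using zR by blast
  qed
qed

text \<open>
  If the diameter is odd, the middle edge can be read in the other direction. If it is even, the edge
  from the centre \<open>a\<close> to its neighbour on the other half of the longest path is also balanced. In both
  cases the new second side lies inside the old first one.
\<close>

lemma balanced_edge_swap:
  obtains a' b' where "balanced_edge a' b' s t" "side b' a' \<subseteq> side a b"
proof (cases "s = t")
  case True
  then have "balanced_edge b a s t" using bal d_sym by (auto simp: balanced_edge_def)
  then show ?thesis using that by blast
next
  case False
  note B = balanced_edgeD[OF bal]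
  have st: "s = Suc t" using False B(4,5) by simp
  obtain u where u: "u \<in> side a b" "d u a = s" using B(7) by blast
  obtain w where w: "w \<in> side b a" "d w b = t" using B(9) by blast
  have uV: "u \<in> V" and wV: "w \<in> V" using u w by (auto simp: side_def)
  have "a \<noteq> u" using u st ab d_0_iff by fastforce
  then obtain c where c: "c \<in> V" "d a c = 1" "d a u = Suc (d c u)" using step_ex[OF ab(1) uV] by blast
  have cL: "c \<in> side a b" using geodesic_stays_left[of u c] u c d_sym[of c u] d_sym[of a u] d_sym[of a c] by simp
  have aL: "a \<in> side a b" using ab d_0_iff by (simp add: side_def)
  have across: "d x c = d x b + 2" "d x a = d x b + 1" if "x \<in> side b a" for x
    using dist_across[OF ba cL that] dist_across[OF ba aL that] c ab d_0_iff by auto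
  have R': "side c a \<subseteq> side a b"
  proof
    fix x assume x: "x \<in> side c a"
    then have "x \<in> V" "d x c < d x a" by (auto simp: side_def)
    then show "x \<in> side a b" using across[of x] by (cases rule: sides_cases) auto
  qed
  have "balanced_edge a c s t"
    unfolding balanced_edge_def
  proof (intro conjI ballI)
    show "a \<in> V" "c \<in> V" "d a c = 1" "t \<le> s" "s \<le> Suc t" using ab c B by auto
    show "d x a \<le> s" if "x \<in> side a c" for x
    proof -
      have "x \<in> V" using that by (simp add: side_def)
      then show ?thesis using across[of x] B(6,8)[of x] st by (cases rule: sides_cases) auto
    qed
    show "\<exists>x\<in>side a c. d x a = s" using across[OF w(1)] w st wV by (intro bexI[of _ w]) (auto simp: side_def)
    show "d y c \<le> t" if "y \<in> side c a" for y
      using that R' B(6)[of y] st by (auto simp: side_def)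
    show "\<exists>y\<in>side c a. d y c = t"
      using c u st d_sym[of c u] d_sym[of a u] uV by (intro bexI[of _ u]) (auto simp: side_def)
  qed
  then show ?thesis using that R' by blast
qed

end
end

section \<open>Equality forces a caterpillar\<close>

text \<open>
  \<open>Trunk\<close> is a longest path. Two vertices of one side are adjacent exactly if they lie on
  consecutive levels and the upper one is on the trunk; thus off the trunk there are only leaves.
\<close>

locale caterpillar_shape = two_sided +
  fixes Trunk :: "'a set"
  assumes R_Trunk: "R \<subseteq> Trunk"
    and Trunk_V: "Trunk \<subseteq> V"
    and inj_R: "inj_on lev R"
    and trunk_vertex: "\<And>i. i \<le> s \<Longrightarrow> \<exists>!x. x \<in> Trunk - R \<and> lev x = i"
    and adjacent: "\<And>x y. \<lbrakk>x \<in> V; y \<in> V\<rbrakk> \<Longrightarrow> d x y = 1 \<longleftrightarrow>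
       (x \<in> R \<longleftrightarrow> y \<in> R) \<and> (Suc (lev x) = lev y \<and> x \<in> Trunk \<or> Suc (lev y) = lev x \<and> y \<in> Trunk)
       \<or> x \<notin> R \<and> y \<in> R \<and> lev x = 0 \<and> lev y = e \<or> x \<in> R \<and> y \<notin> R \<and> lev y = 0 \<and> lev x = e"
begin

text \<open>
  Adjacency in a caterpillar depends only on this data of the two vertices.
\<close>

abbreviation type_of :: "'a \<Rightarrow> nat \<times> bool \<times> bool" where
  "type_of x \<equiv> (lev x, x \<in> R, x \<in> Trunk)"

lemma card_type:
  "card {x \<in> V. type_of x = (i, p, q)} =
     (if p then if q \<and> e \<le> i \<and> i \<le> s then 1 else 0
      else if q then if i \<le> s then 1 else 0
      else card (level i) - (if i \<le> s then 1 else 0) - (if e \<le> i \<and> i \<le> s then 1 else 0))"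
proof -
  have right: "card {x \<in> R. lev x = i} = (if e \<le> i \<and> i \<le> s then 1 else 0)"
  proof (cases "e \<le> i \<and> i \<le> s")
    case True
    then obtain x where "x \<in> R" "lev x = i" using right_ex by blast
    then have "{x \<in> R. lev x = i} = {x}" using inj_R by (auto simp: inj_on_def)
    then show ?thesis using True by simp
  next
    case False
    then have "{x \<in> R. lev x = i} = {}" using lev_R lev_le R_sub by blast
    then have "card {x \<in> R. lev x = i} = 0" by (simp only: card.empty)
    then show ?thesis using False by simp
  qed
  have trunk: "card {x \<in> Trunk - R. lev x = i} = (if i \<le> s then 1 else 0)"
  proof (cases "i \<le> s")
    case True
    then obtain x where "\<forall>y. y \<in> Trunk - R \<and> lev y = i \<longleftrightarrow> y = x"
      using trunk_vertex[OF True] by (auto simp: Ex1_def)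
    then have "{x \<in> Trunk - R. lev x = i} = {x}" by auto
    then show ?thesis using True by simp
  next
    case False
    then have "{x \<in> Trunk - R. lev x = i} = {}" using lev_le Trunk_V by blast
    then have "card {x \<in> Trunk - R. lev x = i} = 0" by (simp only: card.empty)
    then show ?thesis using False by simp
  qed
  show ?thesis
  proof (cases p)
    case True
    have "{x \<in> V. type_of x = (i, p, q)} = (if q then {x \<in> R. lev x = i} else {})"
      using True R_sub R_Trunk by auto
    then show ?thesis using True right by simp
  next
    case False
    show ?thesis
    proof (cases q)
      case True
      then have "{x \<in> V. type_of x = (i, p, q)} = {x \<in> Trunk - R. lev x = i}"
        using \<open>\<not> p\<close> Trunk_V by auto
      then show ?thesis using True \<open>\<not> p\<close> trunk by simp
    next
      case False
      have eq: "{x \<in> V. type_of x = (i, p, q)} = level i - {x \<in> Trunk - R. lev x = i} - {x \<in> R. lev x = i}"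
        using False \<open>\<not> p\<close> R_Trunk by (auto simp: level_def)
      have "{x \<in> Trunk - R. lev x = i} \<subseteq> level i" "{x \<in> R. lev x = i} \<subseteq> level i - {x \<in> Trunk - R. lev x = i}"
        using Trunk_V R_sub by (auto simp: level_def)
      then have "card (level i - {x \<in> Trunk - R. lev x = i} - {x \<in> R. lev x = i})
          = card (level i) - card {x \<in> Trunk - R. lev x = i} - card {x \<in> R. lev x = i}"
        by (simp add: card_Diff_subset finite_subset[OF _ finite_level(1)[of i]] finite_subset[of _ "level i - _"])
      then show ?thesis using False \<open>\<not> p\<close> trunk right eq by simp
    qed
  qed
qed

end

lemma bij_betw_by_type:
  assumes "finite A" "finite B"
    and card: "\<And>k. card {x \<in> A. f x = k} = card {y \<in> B. g y = k}"
  shows "\<exists>\<phi>. bij_betw \<phi> A B \<and> (\<forall>x\<in>A. g (\<phi> x) = f x)"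
proof -
  have "\<forall>k. \<exists>h. bij_betw h {x \<in> A. f x = k} {y \<in> B. g y = k}"
    using assms by (intro allI finite_same_card_bij) auto
  then obtain h where h: "\<And>k. bij_betw (h k) {x \<in> A. f x = k} {y \<in> B. g y = k}" by metis
  define \<phi> where "\<phi> x = h (f x) x" for x
  have to: "\<phi> x \<in> B" "g (\<phi> x) = f x" if "x \<in> A" for x
    using bij_betwE[OF h[of "f x"]] that by (auto simp: \<phi>_def)
  have "inj_on \<phi> A"
  proof (rule inj_onI)
    fix x y assume xy: "x \<in> A" "y \<in> A" "\<phi> x = \<phi> y"
    then have "f x = f y" using to by metis
    then show "x = y" using bij_betw_imp_inj_on[OF h[of "f x"]] xy by (auto simp: \<phi>_def inj_on_def)
  qed
  moreover have "y \<in> \<phi> ` A" if "y \<in> B" for y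
  proof -
    have "y \<in> h (g y) ` {x \<in> A. f x = g y}"
      using bij_betw_imp_surj_on[OF h[of "g y"]] that by simp
    then obtain x where "x \<in> A" "f x = g y" "h (g y) x = y" by auto
    then show ?thesis by (auto simp: \<phi>_def image_iff intro!: bexI[of _ x])
  qed
  ultimately show ?thesis using to by (intro exI[of _ \<phi>]) (auto simp: bij_betw_def)
qed

text \<open>
  The numbers of vertices of each type are determined by the level sizes, so the vertices can be
  matched type by type, and such a matching preserves adjacency.
\<close>

lemma caterpillar_shape_unique:
  assumes "caterpillar_shape V d lev R s e Trunk" "caterpillar_shape V' d' lev' R' s e Trunk'"
    and size: "\<And>i. card {x \<in> V. lev x = i} = card {x \<in> V'. lev' x = i}"
  shows "\<exists>\<phi>. bij_betw \<phi> V V' \<and> (\<forall>x\<in>V. \<forall>y\<in>V. d' (\<phi> x) (\<phi> y) = 1 \<longleftrightarrow> d x y = 1)"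
proof -
  interpret A: caterpillar_shape V d lev R s e Trunk by fact
  interpret B: caterpillar_shape V' d' lev' R' s e Trunk' by fact
  have "card {x \<in> V. A.type_of x = k} = card {x \<in> V'. B.type_of x = k}" for k
    using size by (cases k) (simp only: A.card_type B.card_type A.level_def B.level_def)
  then obtain \<phi> where \<phi>: "bij_betw \<phi> V V'" "\<forall>x\<in>V. B.type_of (\<phi> x) = A.type_of x"
    using bij_betw_by_type[OF A.finite_V B.finite_V, of A.type_of B.type_of] by blast
  have V': "\<phi> x \<in> V'" if "x \<in> V" for x using \<phi>(1) that by (auto dest: bij_betwE)
  have "d' (\<phi> x) (\<phi> y) = 1 \<longleftrightarrow> d x y = 1" if "x \<in> V" "y \<in> V" for x y
    unfolding A.adjacent[OF that] B.adjacent[OF that[THEN V']] using \<phi>(2) that by simp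
  then show ?thesis using \<phi>(1) by blast
qed

context tree_metric
begin

text \<open>
  Fix a vertex \<open>u\<close> on the deepest level of the left side and let \<open>P\<close> be its ancestors there. If the
  parent \<open>x\<close> of some \<open>y\<close> were not in \<open>P\<close>, the vertex \<open>z\<close> of \<open>P\<close> on the level of \<open>y\<close> would be unrelated to
  \<open>y\<close>, hence at distance 2 from it by tightness; but then \<open>y\<close> and \<open>z\<close> share their parent, which is in
  \<open>P\<close>.
\<close>

lemma tight_imp_caterpillar_shape:
  assumes bal: "balanced_edge a b s t"
    and tight: "two_sided.tight V d (depth t) (side b a)"
    and inj: "inj_on (depth t) (side b a)"
  shows "\<exists>Trunk. caterpillar_shape V d (depth t) (side b a) s (s - t) Trunk"
proof -
  interpret S: two_sided V d "depth t" "side b a" s "s - t" by (rule two_sided[OF bal])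
  note ab = balanced_edgeD(1-3)[OF bal]
  note left = depth_left[OF bal] and right = depth_right[OF bal]
  let ?L = "side a b" and ?R = "side b a"
  have LR: "x \<in> ?L \<longleftrightarrow> x \<notin> ?R" if "x \<in> V" for x
    using that sides_cases[OF bal that] sides_disjoint[OF bal] by blast
  have LV: "x \<in> V" if "x \<in> ?L \<or> x \<in> ?R" for x using that by (auto simp: side_def)
  have crossing: "d x y = depth t x + depth t y + 1 - (s - t)" if "x \<in> ?L" "y \<in> ?R" for x y
    using dist_across[OF ab that(2,1)] left right that d_sym[of b y] by simp
  have crossing_1: "d x y = 1 \<longleftrightarrow> depth t x = 0 \<and> depth t y = s - t" if "x \<in> ?L" "y \<in> ?R" for x y
    using crossing[OF that] S.lev_R[OF that(2)] by linarith
  obtain u where u: "u \<in> ?L" "d u a = s" using balanced_edgeD(7)[OF bal] by blast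
  have uV: "u \<in> V" and du: "depth t u = s" using u left by (auto simp: side_def)
  define P where "P = {x \<in> ?L. d x u = s - depth t x}"
  have P_ex1: "\<exists>!x. x \<in> P \<and> depth t x = i" if "i \<le> s" for i
  proof -
    have "x \<in> ?L" if x: "x \<in> V" "depth t x = i" "d x u = s - i" for x
    proof (rule ccontr)
      assume "x \<notin> ?L"
      then have xR: "x \<in> ?R" using LR x by blast
      then show False using crossing[OF u(1) xR] S.lev_R[OF xR] x du d_sym[of x u] \<open>i \<le> s\<close> by linarith
    qed
    moreover have "\<exists>!x. x \<in> V \<and> depth t x = i \<and> d x u = s - i" using S.ancestor[OF uV, of i] du that by simp
    ultimately show ?thesis unfolding P_def using LV by (smt (verit, best) mem_Collect_eq)
  qed
  have adj_depth: "depth t y = Suc (depth t x) \<or> depth t x = Suc (depth t y)"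
    if "x \<in> V" "y \<in> V" "x \<in> ?R \<longleftrightarrow> y \<in> ?R" "d x y = 1" for x y
  proof (cases "x \<in> ?R")
    case True
    then show ?thesis using adjacent_dist[OF that(1,2) ab(2) that(4)] right that by auto
  next
    case False
    then show ?thesis using adjacent_dist[OF that(1,2) ab(1) that(4)] left LR that by auto
  qed
  have parent_in_P: "x \<in> P"
    if xy: "x \<in> ?L" "y \<in> ?L" "d x y = 1" "depth t y = Suc (depth t x)" for x y
  proof -
    have V: "x \<in> V" "y \<in> V" using xy LV by auto
    have "d x u = s - depth t x" if "d x u \<le> s - depth t x"
    proof -
      have "s \<le> d x u + depth t x" using triangle[OF uV V(1) ab(1)] u left[OF xy(1)] d_sym[of u x] by simp
      then show ?thesis using that by linarith
    qed
    moreover have "d x u \<le> s - depth t x"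
    proof -
      have ys: "depth t y \<le> s" using S.lev_le V by blast
      obtain z where z: "z \<in> P" "depth t z = depth t y" using P_ex1[OF ys] by blast
      have zL: "z \<in> ?L" and zV: "z \<in> V" and zu: "d z u = s - depth t y"
        using z by (auto simp: P_def side_def)
      show ?thesis
      proof (cases "z = y")
        case True
        then show ?thesis using triangle[OF V uV] zu xy ys by simp
      next
        case False
        have "d z y \<noteq> 0" using False d_0_iff zV V by blast
        then have zy: "d z y = 2"
          using tight zV V zL xy LR z(2) unfolding S.tight_def by (force simp: gap_def)
        (* The vertex between z and y is their common parent: a common child would have two ancestors
             on one level. *)
        obtain w where w: "w \<in> V" "d z w = 1" "d z y = 1 + d w y"
          using geodesic_ex[OF zV V(2), of 1] zy by auto
        have wy: "d w y = 1" "d w z = 1" using w zy d_sym by auto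
        have wL: "w \<in> ?L"
        proof (rule ccontr)
          assume "w \<notin> ?L"
          then show False using crossing_1[OF xy(2), of w] LR w wy xy(4) d_sym[of w y] by auto
        qed
        have "depth t y = Suc (depth t w) \<or> depth t w = Suc (depth t y)"
          using adj_depth[OF w(1) V(2)] wL xy LR w V wy by blast
        then show ?thesis
        proof
          assume "depth t y = Suc (depth t w)"
          then have "w = x" using S.ancestor[OF V(2), of "depth t x"] w V xy wy by auto
          then show ?thesis using triangle[OF V(1) zV uV] w wy zu xy ys by simp
        next
          assume "depth t w = Suc (depth t y)"
          then have "z = y" using S.ancestor[OF w(1), of "depth t y"] w V zV wy z d_sym[of y w] by auto
          then show ?thesis using False by simp
        qed
      qed
    qed
    ultimately show ?thesis using xy by (simp add: P_def)
  qed
  have parent: "\<exists>x. x \<in> V \<and> d x y = 1 \<and> depth t x = i \<and> (x \<in> ?R \<longleftrightarrow> y \<in> ?R)"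
    if y: "y \<in> V" "depth t y = Suc i" "y \<in> ?R \<Longrightarrow> s - t \<le> i" for y i
  proof -
    obtain x where x: "x \<in> V" "depth t x = i" "d x y = 1" using S.ancestor[OF y(1), of i] y by auto
    have "x \<in> ?R \<longleftrightarrow> y \<in> ?R"
      using crossing_1[of x y] crossing_1[of y x] x y LR S.lev_R d_sym[of x y] by fastforce
    then show ?thesis using x by blast
  qed
  have down: "d x y = 1 \<longleftrightarrow> x \<in> P \<union> ?R"
    if xy: "x \<in> V" "y \<in> V" "x \<in> ?R \<longleftrightarrow> y \<in> ?R" "depth t y = Suc (depth t x)" for x y
  proof
    show "x \<in> P \<union> ?R" if "d x y = 1" using parent_in_P[of x y] xy LR that by blast
    assume xT: "x \<in> P \<union> ?R"
    have "y \<in> ?R \<Longrightarrow> s - t \<le> depth t x" using xy S.lev_R by blast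
    then obtain z where z: "z \<in> V" "d z y = 1" "depth t z = depth t x" "z \<in> ?R \<longleftrightarrow> y \<in> ?R"
      using parent[OF xy(2,4)] by blast
    have "z = x"
    proof (cases "y \<in> ?R")
      case True
      then show ?thesis using inj z xy by (auto simp: inj_on_def)
    next
      case False
      then have "z \<in> P" "x \<in> P" using parent_in_P[of z y] z xy xT LR by auto
      then show ?thesis using P_ex1[of "depth t x"] S.lev_le xy z by blast
    qed
    then show "d x y = 1" using z by simp
  qed
  have "caterpillar_shape V d (depth t) ?R s (s - t) (P \<union> ?R)"
  proof unfold_locales
    show "?R \<subseteq> P \<union> ?R" by blast
    show "P \<union> ?R \<subseteq> V" using LV by (auto simp: P_def)
    show "inj_on (depth t) ?R" by (rule inj)
    show "\<exists>!x. x \<in> P \<union> ?R - ?R \<and> depth t x = i" if "i \<le> s" for i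
    proof -
      have "P \<union> ?R - ?R = P" using sides_disjoint[OF bal] by (auto simp: P_def)
      then show ?thesis using P_ex1[OF that] by simp
    qed
    show "d x y = 1 \<longleftrightarrow>
       (x \<in> ?R \<longleftrightarrow> y \<in> ?R) \<and> (Suc (depth t x) = depth t y \<and> x \<in> P \<union> ?R \<or> Suc (depth t y) = depth t x \<and> y \<in> P \<union> ?R)
       \<or> x \<notin> ?R \<and> y \<in> ?R \<and> depth t x = 0 \<and> depth t y = s - t
       \<or> x \<in> ?R \<and> y \<notin> ?R \<and> depth t y = 0 \<and> depth t x = s - t" if xy: "x \<in> V" "y \<in> V" for x y
    proof (cases "x \<in> ?R \<longleftrightarrow> y \<in> ?R")
      case True
      then show ?thesis using adj_depth[OF xy True] down[OF xy True] down[of y x] xy d_sym[of x y] by auto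
    next
      case False
      then show ?thesis using crossing_1[of x y] crossing_1[of y x] LR xy d_sym[of x y] by auto
    qed
  qed
  then show ?thesis by blast
qed

text \<open>
  If the second side is not a path, the hypothesis leaves the first side one vertex on each level
  deeper than \<open>s - t\<close>. After moving to another middle edge, the new second side lies within the first
  and has a single vertex on its own first level, so it is a path.
\<close>

lemma balanced_edge_with_path_side:
  assumes bal: "balanced_edge a b s t"
    and thin: "\<And>i j. \<lbrakk>s - t < i; s - t < j; i \<le> s; j \<le> s\<rbrakk> \<Longrightarrow>
        card {x \<in> side a b. depth t x = i} = 1 \<or> card {x \<in> side b a. depth t x = j} = 1"
  shows "\<exists>a' b'. balanced_edge a' b' s t \<and> inj_on (depth t) (side b' a')"
proof -
  have first: "x = y" if "balanced_edge a b s t" "x \<in> side b a" "y \<in> side b a"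
      "depth t x = s - t" "depth t y = s - t" for x y a b
    using depth_right[OF that(1)] that d_0_iff balanced_edgeD(2)[OF that(1)] by (auto simp: side_def)
  have bound: "s - t \<le> depth t x" "depth t x \<le> s" if "balanced_edge a b s t" "x \<in> side b a" for x a b
    using depth_right[OF that] balanced_edgeD(4)[OF that(1)] balanced_edgeD(8)[OF that] by linarith+
  show ?thesis
  proof (cases "inj_on (depth t) (side b a)")
    case True
    then show ?thesis using bal by blast
  next
    case False
    then obtain x y where xy: "x \<in> side b a" "y \<in> side b a" "x \<noteq> y" "depth t x = depth t y"
      by (auto simp: inj_on_def)
    have j: "s - t < depth t x" using first[OF bal xy(1,2)] bound[OF bal xy(1)] xy by fastforce
    have "card {z \<in> side b a. depth t z = depth t x} \<noteq> 1"
    proof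
      assume "card {z \<in> side b a. depth t z = depth t x} = 1"
      then obtain w where w: "{z \<in> side b a. depth t z = depth t x} = {w}" by (rule card_1_singletonE)
      have "x \<in> {z \<in> side b a. depth t z = depth t x}" "y \<in> {z \<in> side b a. depth t z = depth t x}"
        using xy by simp_all
      then show False using xy(3) unfolding w by simp
    qed
    then have one: "card {z \<in> side a b. depth t z = i} = 1" if "s - t < i" "i \<le> s" for i
      using thin[OF that(1) j that(2)] bound[OF bal xy(1)] by blast
    obtain a' b' where b': "balanced_edge a' b' s t" "side b' a' \<subseteq> side a b"
      using balanced_edge_swap[OF bal] by blast
    have "inj_on (depth t) (side b' a')"
    proof (rule inj_onI)
      fix x y assume h: "x \<in> side b' a'" "y \<in> side b' a'" "depth t x = depth t y"
      show "x = y"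
      proof (cases "depth t x = s - t")
        case True
        then show ?thesis using first[OF b'(1) h(1,2)] h(3) by simp
      next
        case False
        then have "card {z \<in> side a b. depth t z = depth t x} = 1"
          using one bound[OF b'(1) h(1)] by simp
        then obtain w where w: "{z \<in> side a b. depth t z = depth t x} = {w}" by (rule card_1_singletonE)
        have "x \<in> {z \<in> side a b. depth t z = depth t x}" "y \<in> {z \<in> side a b. depth t z = depth t x}"
          using h b'(2) by auto
        then show ?thesis unfolding w by simp
      qed
    qed
    then show ?thesis using b' by blast
  qed
qed

end

section \<open>Finite graphs\<close>

context pair_graph
begin

lemma set_rev_path: "(x, y) \<in> set (rev_path p) \<longleftrightarrow> (y, x) \<in> set p"
  by (induct p) auto

lemma gdist_le: "awalk u p v \<Longrightarrow> gdist G u v \<le> length p"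
  unfolding gdist_def by (rule Least_le) blast

text \<open>
  A function that grows by at most one along arcs bounds the length of walks from below; if it can
  always be decreased by a step, such a bound is attained.
\<close>

lemma gdist_eqI:
  assumes refl: "\<And>x. x \<in> pverts G \<Longrightarrow> \<delta> x x = 0"
    and arc: "\<And>x y z. \<lbrakk>(x, y) \<in> parcs G; z \<in> pverts G\<rbrakk> \<Longrightarrow> \<delta> x z \<le> Suc (\<delta> y z)"
    and step: "\<And>x z. \<lbrakk>x \<in> pverts G; z \<in> pverts G; x \<noteq> z\<rbrakk> \<Longrightarrow> \<exists>y. (x, y) \<in> parcs G \<and> \<delta> x z = Suc (\<delta> y z)"
    and xz: "x \<in> pverts G" "z \<in> pverts G"
  shows "gdist G x z = \<delta> x z"
proof -
  have lower: "\<delta> x z \<le> length p" if "awalk x p z" for x p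
    using that
  proof (induction p arbitrary: x)
    case Nil
    then show ?case using refl xz by (simp add: awalk_Nil_iff)
  next
    case (Cons e p)
    then have "(x, snd e) \<in> parcs G" "awalk (snd e) p z" by (auto simp: awalk_Cons_iff)
    then show ?case using Cons.IH[of "snd e"] arc[of x "snd e" z] xz by fastforce
  qed
  have upper: "\<exists>p. awalk x p z \<and> length p = \<delta> x z" if "x \<in> pverts G" for x
    using that
  proof (induction "\<delta> x z" arbitrary: x)
    case 0
    then have "x = z" using step[of x z] xz by fastforce
    then show ?case using xz refl by (intro exI[of _ "[]"]) (auto simp: awalk_Nil_iff)
  next
    case (Suc n)
    then have "x \<noteq> z" using refl Suc by (metis Zero_not_Suc)
    then obtain y where y: "(x, y) \<in> parcs G" "\<delta> x z = Suc (\<delta> y z)" using step Suc xz by blast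
    then obtain p where "awalk y p z" "length p = \<delta> y z" using Suc in_arcsD2 by (metis nat.inject)
    then show ?case using y in_arcsD1 by (intro exI[of _ "(x, y) # p"]) (auto simp: awalk_Cons_iff)
  qed
  show ?thesis
    unfolding gdist_def using upper[OF xz(1)] lower by (intro Least_equality) auto
qed

text \<open>
  Shortening the walk to a path keeps it from using the arc \<open>(a, b)\<close>, so the path has length at least 2
  and the arc back closes a cycle of length at least 3.
\<close>

lemma walk_and_arc_imp_long_cycle:
  assumes walk: "awalk a p b" and arc: "(b, a) \<in> parcs G" and avoid: "(a, b) \<notin> set p"
  shows "\<exists>c. cycle c \<and> 3 \<le> length c"
proof -
  define q where "q = awalk_to_apath p"
  have q: "apath a q b" "set q \<subseteq> set p"
    unfolding q_def using apath_awalk_to_apath[OF walk] awalk_to_apath_subset[OF walk] by auto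
  have walk_q: "awalk a q b" "distinct (awalk_verts a q)" using q by (auto simp: apath_def)
  have "a \<noteq> b" using no_loops'[OF arc] by simp
  have "2 \<le> length q"
  proof (rule ccontr)
    assume "\<not> 2 \<le> length q"
    then consider "q = []" | e where "q = [e]" by (cases q) (auto simp: Suc_le_eq)
    then show False
    proof cases
      case 1
      then show ?thesis using walk_q \<open>a \<noteq> b\<close> by (simp add: awalk_Nil_iff)
    next
      case 2
      then have "e = (a, b)" using walk_q by (cases e) (auto simp: awalk_simps)
      then show ?thesis using 2 q avoid by auto
    qed
  qed
  have "awalk a (q @ [(b, a)]) a"
    using walk_q arc in_arcsD2 by (auto simp: awalk_simps)
  moreover have "distinct (tl (awalk_verts a (q @ [(b, a)])))"
  proof -
    have "awalk_verts a (q @ [(b, a)]) = awalk_verts a q @ [a]"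
      using awalk_verts_append[OF \<open>awalk a (q @ [(b, a)]) a\<close>] by simp
    moreover obtain vs where "awalk_verts a q = a # vs"
      using walk_q(1) by (cases q) (auto simp: awalk_Cons_iff)
    ultimately show ?thesis using walk_q(2) by auto
  qed
  ultimately have "cycle (q @ [(b, a)])" unfolding cycle_def by blast
  then show ?thesis using \<open>2 \<le> length q\<close> by (intro exI[of _ "q @ [(b, a)]"]) simp
qed

lemma gdist_on_walk:
  assumes "awalk u p v" "(x, y) \<in> set p"
  shows "gdist G x v \<le> length p" "gdist G y v < length p"
proof -
  obtain p1 p2 where p: "p = p1 @ (x, y) # p2" using assms(2) by (meson split_list)
  then have w: "awalk x ((x, y) # p2) v" "awalk y p2 v" using assms(1) by (auto simp: awalk_Cons_iff)
  show "gdist G x v \<le> length p" "gdist G y v < length p"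
    using p gdist_le[OF w(1)] gdist_le[OF w(2)] by simp_all
qed

context
  assumes conn: "connected G"
begin

lemma gdist_walk:
  assumes "u \<in> pverts G" "v \<in> pverts G"
  obtains p where "awalk u p v" "length p = gdist G u v"
proof -
  have "strongly_connected G"
    using symmetric_connected_imp_strongly_connected[OF pair_sym_arcs conn] .
  then have "u \<rightarrow>\<^sup>*\<^bsub>G\<^esub> v" using assms by (auto simp: strongly_connected_def)
  then have "\<exists>q. awalk u q v" using reachable_awalk by simp
  then have "\<exists>k p. awalk u p v \<and> length p = k" by blast
  then have "\<exists>p. awalk u p v \<and> length p = gdist G u v" unfolding gdist_def by (rule LeastI_ex)
  then show ?thesis using that by blast
qed

lemma gdist_0_iff: "\<lbrakk>u \<in> pverts G; v \<in> pverts G\<rbrakk> \<Longrightarrow> gdist G u v = 0 \<longleftrightarrow> u = v"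
proof
  assume V: "u \<in> pverts G" "v \<in> pverts G"
  show "u = v" if "gdist G u v = 0"
  proof -
    obtain p where "awalk u p v" "length p = gdist G u v" using gdist_walk[OF V] .
    then show ?thesis using that by (simp add: awalk_Nil_iff)
  qed
  show "gdist G u v = 0" if "u = v"
    using gdist_le[of u "[]" v] V that by (simp add: awalk_Nil_iff)
qed

lemma gdist_arc_le:
  assumes "(x, y) \<in> parcs G" "z \<in> pverts G"
  shows "gdist G x z \<le> Suc (gdist G y z)"
proof -
  obtain p where "awalk y p z" "length p = gdist G y z"
    using gdist_walk[OF in_arcsD2[OF assms(1)] assms(2)] .
  then show ?thesis using gdist_le[of x "(x, y) # p" z] assms in_arcsD1 by (auto simp: awalk_Cons_iff)
qed

lemma gdist_step:
  assumes "x \<in> pverts G" "z \<in> pverts G" "x \<noteq> z"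
  shows "\<exists>y. (x, y) \<in> parcs G \<and> gdist G x z = Suc (gdist G y z)"
proof -
  obtain p where p: "awalk x p z" "length p = gdist G x z" using gdist_walk[OF assms(1,2)] .
  then obtain y q where q: "p = (x, y) # q" "(x, y) \<in> parcs G" "awalk y q z"
    using assms(3) by (cases p) (auto simp: awalk_Nil_iff awalk_Cons_iff)
  then show ?thesis using gdist_le[OF q(3)] gdist_arc_le[OF q(2) assms(2)] p by fastforce
qed

lemma gdist_1_iff: "\<lbrakk>x \<in> pverts G; y \<in> pverts G\<rbrakk> \<Longrightarrow> gdist G x y = 1 \<longleftrightarrow> (x, y) \<in> parcs G"
proof
  assume V: "x \<in> pverts G" "y \<in> pverts G"
  show "(x, y) \<in> parcs G" if d1: "gdist G x y = 1"
  proof -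
    have "x \<noteq> y" using d1 gdist_0_iff[OF V] by auto
    then obtain z where z: "(x, z) \<in> parcs G" "gdist G z y = 0" using gdist_step[OF V] d1 by auto
    then show ?thesis using gdist_0_iff[OF in_arcsD2[OF z(1)] V(2)] by blast
  qed
  show "gdist G x y = 1" if "(x, y) \<in> parcs G"
  proof -
    have "gdist G x y \<noteq> 0" using no_loops'[OF that] gdist_0_iff[OF V] by blast
    moreover have "gdist G y y = 0" using gdist_0_iff[OF V(2,2)] by simp
    ultimately show ?thesis using gdist_arc_le[OF that V(2)] by linarith
  qed
qed

end

text \<open>
  Two different steps towards the same target, or two adjacent vertices equally far from it, would give
  a walk around an arc that avoids it, hence a cycle.
\<close>

lemma tree_metric_gdist:
  assumes conn: "connected G" and acyclic: "\<not> (\<exists>c. cycle c \<and> 3 \<le> length c)"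
  shows "tree_metric (pverts G) (gdist G)"
proof
  note one = gdist_1_iff[OF conn]
  show "finite (pverts G)" by (rule pair_finite_verts)
  show "gdist G x y = 0 \<longleftrightarrow> x = y" if "x \<in> pverts G" "y \<in> pverts G" for x y
    using gdist_0_iff[OF conn that] .
  show "gdist G x y = gdist G y x" for x y by (rule gdist_commute)
  show "\<exists>z\<in>pverts G. gdist G x z = 1 \<and> gdist G x y = Suc (gdist G z y)"
    if "x \<in> pverts G" "y \<in> pverts G" "x \<noteq> y" for x y
    using gdist_step[OF conn that] one[OF that(1)] in_arcsD2 by blast
  show "z = z'"
    if V: "x \<in> pverts G" "y \<in> pverts G" "z \<in> pverts G" "z' \<in> pverts G"
      and "gdist G x z = 1" "gdist G x z' = 1"
      and d: "gdist G x y = Suc (gdist G z y)" "gdist G x y = Suc (gdist G z' y)" for x y z z'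
  proof (rule ccontr)
    assume "z \<noteq> z'"
    have arcs: "(x, z) \<in> parcs G" "(z', x) \<in> parcs G" using that one arcs_symmetric by blast+
    obtain p where p: "awalk z p y" "length p = gdist G z y" using gdist_walk[OF conn V(3,2)] .
    obtain p' where p': "awalk z' p' y" "length p' = gdist G z' y" using gdist_walk[OF conn V(4,2)] .
    (* Walk from z to y, back to z' and on to x: the arc (z, x) is avoided because x is farther
       from y than everything on the two geodesics. *)
    have "awalk z (p @ rev_path p' @ [(z', x)]) x"
      using p p' arcs V by (auto simp: awalk_simps)
    moreover have "(z, x) \<notin> set p" using gdist_on_walk(2)[OF p(1)] p d by fastforce
    moreover have "(x, z) \<notin> set p'" using gdist_on_walk(1)[OF p'(1)] p' d by fastforce
    ultimately have "awalk z (p @ rev_path p' @ [(z', x)]) x" "(z, x) \<notin> set (p @ rev_path p' @ [(z', x)])"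
      using \<open>z \<noteq> z'\<close> by (simp_all add: set_rev_path)
    then show False using walk_and_arc_imp_long_cycle[OF _ arcs(1)] acyclic by blast
  qed
  show "gdist G x z = Suc (gdist G y z) \<or> gdist G y z = Suc (gdist G x z)"
    if V: "x \<in> pverts G" "y \<in> pverts G" "z \<in> pverts G" and xy: "gdist G x y = 1" for x y z
  proof -
    have arcs: "(x, y) \<in> parcs G" "(y, x) \<in> parcs G" using that one arcs_symmetric by blast+
    have "gdist G x z \<noteq> gdist G y z"
    proof
      assume eq: "gdist G x z = gdist G y z"
      obtain p where p: "awalk x p z" "length p = gdist G x z" using gdist_walk[OF conn V(1,3)] .
      obtain q where q: "awalk y q z" "length q = gdist G y z" using gdist_walk[OF conn V(2,3)] .
      have "awalk x (p @ rev_path q) y" using p q by auto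
      moreover have "(x, y) \<notin> set p" using gdist_on_walk(2)[OF p(1)] p eq by fastforce
      moreover have "(y, x) \<notin> set q" using gdist_on_walk(2)[OF q(1)] q eq by fastforce
      ultimately have "awalk x (p @ rev_path q) y" "(x, y) \<notin> set (p @ rev_path q)"
        by (simp_all add: set_rev_path)
      then show False using walk_and_arc_imp_long_cycle[OF _ arcs(2)] acyclic by blast
    qed
    then show ?thesis using gdist_arc_le[OF conn arcs(1) V(3)] gdist_arc_le[OF conn arcs(2) V(3)] by linarith
  qed
qed

text \<open>
  The value at 0 is reset so that the diagonal drops out of the sum over ordered pairs.
\<close>

lemma gen_wiener_double_sum:
  assumes zero: "\<And>x y. \<lbrakk>x \<in> pverts G; y \<in> pverts G\<rbrakk> \<Longrightarrow> gdist G x y = 0 \<longleftrightarrow> x = y"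
  shows "2 * gen_wiener G g = (\<Sum>x\<in>pverts G. \<Sum>y\<in>pverts G. (g(0 := 0)) (gdist G x y))"
proof -
  let ?V = "pverts G" and ?E = "{e. e \<subseteq> pverts G \<and> card e = 2}"
  let ?P = "{(x, y). x \<in> pverts G \<and> y \<in> pverts G \<and> x \<noteq> y}"
  let ?f = "\<lambda>(x, y). (g(0 := 0)) (gdist G x y)"
  have fin: "finite (?V \<times> ?V)" "finite ?P" "finite ?E"
    using pair_finite_verts by (auto intro: finite_subset[of ?P "?V \<times> ?V"])
  have "(\<Sum>x\<in>?V. \<Sum>y\<in>?V. (g(0 := 0)) (gdist G x y)) = sum ?f (?V \<times> ?V)"
    by (simp add: sum.cartesian_product)
  also have "\<dots> = sum ?f ?P"
    using fin zero by (intro sum.mono_neutral_right) auto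
  also have "\<dots> = (\<Sum>e\<in>?E. sum ?f {p \<in> ?P. (\<lambda>(x, y). {x, y}) p = e})"
    by (rule sum.group[symmetric]) (use fin in \<open>auto simp: card_2_iff\<close>)
  also have "\<dots> = (\<Sum>e\<in>?E. 2 * g (pair_dist G e))"
  proof (rule sum.cong[OF refl])
    fix e assume "e \<in> ?E"
    then obtain x y where xy: "e = {x, y}" "x \<noteq> y" "x \<in> ?V" "y \<in> ?V" by (auto simp: card_2_iff)
    have "{p \<in> ?P. (\<lambda>(x, y). {x, y}) p = e} = {(x, y), (y, x)}"
      using xy by (auto simp: doubleton_eq_iff)
    moreover have "gdist G x y \<noteq> 0" using zero xy by simp
    ultimately show "sum ?f {p \<in> ?P. (\<lambda>(x, y). {x, y}) p = e} = 2 * g (pair_dist G e)"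
      using xy gdist_commute[of x y] by (simp add: pair_dist_eq)
  qed
  finally show ?thesis by (simp add: gen_wiener_def sum_distrib_left)
qed

end

lemma digraph_iso_iff:
  assumes "pair_graph G" "pair_graph H"
  shows "digraph_iso (with_proj G) (with_proj H) \<longleftrightarrow>
    (\<exists>\<phi>. bij_betw \<phi> (pverts G) (pverts H) \<and>
       (\<forall>x\<in>pverts G. \<forall>y\<in>pverts G. (\<phi> x, \<phi> y) \<in> parcs H \<longleftrightarrow> (x, y) \<in> parcs G))"
proof
  interpret G: pair_graph G by fact
  interpret H: pair_graph H by fact
  show "\<exists>\<phi>. bij_betw \<phi> (pverts G) (pverts H) \<and>
       (\<forall>x\<in>pverts G. \<forall>y\<in>pverts G. (\<phi> x, \<phi> y) \<in> parcs H \<longleftrightarrow> (x, y) \<in> parcs G)"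
    if iso: "digraph_iso (with_proj G) (with_proj H)"
  proof -
    obtain f where f: "pre_digraph.digraph_isomorphism (with_proj G) f" "with_proj H = app_iso f (with_proj G)"
      using iso unfolding digraph_iso_def by blast
    have H: "pverts H = iso_verts f ` pverts G" "parcs H = iso_arcs f ` parcs G"
        "fst = iso_tail f" "snd = iso_head f"
      using f(2) by (simp_all add: with_proj_def app_iso_def)
    have inj: "inj_on (iso_verts f) (pverts G)"
      and ends: "\<And>a. a \<in> parcs G \<Longrightarrow> iso_arcs f a = (iso_verts f (fst a), iso_verts f (snd a))"
      using f(1) unfolding pre_digraph.digraph_isomorphism_def by (auto simp: prod_eq_iff H(3,4)[symmetric])
    have "(iso_verts f x, iso_verts f y) \<in> parcs H \<longleftrightarrow> (x, y) \<in> parcs G" if "x \<in> pverts G" "y \<in> pverts G" for x y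
    proof
      assume "(x, y) \<in> parcs G"
      then show "(iso_verts f x, iso_verts f y) \<in> parcs H" using ends[of "(x, y)"] H by force
    next
      assume "(iso_verts f x, iso_verts f y) \<in> parcs H"
      then obtain a where a: "a \<in> parcs G" "iso_arcs f a = (iso_verts f x, iso_verts f y)" unfolding H by force
      then have "fst a = x" "snd a = y"
        using ends[OF a(1)] inj that G.arc_fst_in_verts G.arc_snd_in_verts by (auto dest: inj_onD)
      then show "(x, y) \<in> parcs G" using a by force
    qed
    then show ?thesis using inj H by (intro exI[of _ "iso_verts f"]) (auto simp: bij_betw_def)
  qed
  assume "\<exists>\<phi>. bij_betw \<phi> (pverts G) (pverts H) \<and>
       (\<forall>x\<in>pverts G. \<forall>y\<in>pverts G. (\<phi> x, \<phi> y) \<in> parcs H \<longleftrightarrow> (x, y) \<in> parcs G)"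
  then obtain \<phi> where \<phi>: "bij_betw \<phi> (pverts G) (pverts H)"
    "\<And>x y. \<lbrakk>x \<in> pverts G; y \<in> pverts G\<rbrakk> \<Longrightarrow> (\<phi> x, \<phi> y) \<in> parcs H \<longleftrightarrow> (x, y) \<in> parcs G" by blast
  let ?f = "\<lparr>iso_verts = \<phi>, iso_arcs = map_prod \<phi> \<phi>, iso_head = snd, iso_tail = fst\<rparr>"
  have inj: "inj_on \<phi> (pverts G)" and im: "\<phi> ` pverts G = pverts H" using \<phi>(1) by (auto simp: bij_betw_def)
  have "map_prod \<phi> \<phi> ` parcs G = parcs H"
  proof
    show "map_prod \<phi> \<phi> ` parcs G \<subseteq> parcs H" using \<phi>(2) G.in_arcsD1 G.in_arcsD2 by auto
    show "parcs H \<subseteq> map_prod \<phi> \<phi> ` parcs G"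
    proof
      fix a assume a: "a \<in> parcs H"
      then have "fst a \<in> \<phi> ` pverts G" "snd a \<in> \<phi> ` pverts G"
        using im H.arc_fst_in_verts H.arc_snd_in_verts by auto
      then obtain x y where "x \<in> pverts G" "y \<in> pverts G" "a = (\<phi> x, \<phi> y)" by (auto simp: prod_eq_iff)
      then show "a \<in> map_prod \<phi> \<phi> ` parcs G" using \<phi>(2) a by (force simp: image_iff)
    qed
  qed
  then have "with_proj H = app_iso ?f (with_proj G)"
    using im by (simp add: with_proj_def app_iso_def)
  moreover have "inj_on (map_prod \<phi> \<phi>) (parcs G)"
    using map_prod_inj_on[OF inj inj]
    by (rule inj_on_subset) (auto simp: G.in_arcsD1 G.in_arcsD2)
  then have "pre_digraph.digraph_isomorphism (with_proj G) ?f"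
    unfolding pre_digraph.digraph_isomorphism_def
    using inj G.wf_digraph_axioms by simp
  ultimately show "digraph_iso (with_proj G) (with_proj H)" unfolding digraph_iso_def by blast
qed

section \<open>The extremal caterpillar\<close>

text \<open>
  A tree metric is determined by its adjacency, up to renaming of the vertices.
\<close>

lemma (in pair_graph) gdist_eq_tree_metric:
  assumes "tree_metric W \<delta>" and bij: "bij_betw \<phi> (pverts G) W"
    and arcs: "\<And>x y. \<lbrakk>x \<in> pverts G; y \<in> pverts G\<rbrakk> \<Longrightarrow> (x, y) \<in> parcs G \<longleftrightarrow> \<delta> (\<phi> x) (\<phi> y) = 1"
    and xz: "x \<in> pverts G" "z \<in> pverts G"
  shows "gdist G x z = \<delta> (\<phi> x) (\<phi> z)"
proof -
  interpret tree_metric W \<delta> by fact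
  have W: "\<phi> x \<in> W" if "x \<in> pverts G" for x using bij_betwE[OF bij] that by blast
  show ?thesis
  proof (rule gdist_eqI[OF _ _ _ xz])
    show "\<delta> (\<phi> x) (\<phi> x) = 0" if "x \<in> pverts G" for x using d_0_iff W that by blast
    show "\<delta> (\<phi> x) (\<phi> z) \<le> Suc (\<delta> (\<phi> y) (\<phi> z))" if "(x, y) \<in> parcs G" "z \<in> pverts G" for x y z
    proof -
      have V: "x \<in> pverts G" "y \<in> pverts G" using that in_arcsD1 in_arcsD2 by blast+
      then have "\<delta> (\<phi> x) (\<phi> y) = 1" using arcs that(1) by blast
      then show ?thesis using adjacent_dist[OF W[OF V(1)] W[OF V(2)] W[OF that(2)]] by auto
    qed
    show "\<exists>y. (x, y) \<in> parcs G \<and> \<delta> (\<phi> x) (\<phi> z) = Suc (\<delta> (\<phi> y) (\<phi> z))"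
      if xz: "x \<in> pverts G" "z \<in> pverts G" "x \<noteq> z" for x z
    proof -
      have "\<phi> x \<noteq> \<phi> z" using bij xz by (auto simp: bij_betw_def inj_on_def)
      then obtain w where w: "w \<in> W" "\<delta> (\<phi> x) w = 1" "\<delta> (\<phi> x) (\<phi> z) = Suc (\<delta> w (\<phi> z))"
        using step_ex W xz by blast
      then obtain y where y: "y \<in> pverts G" "w = \<phi> y" using bij_betw_imp_surj_on[OF bij] by blast
      then show ?thesis using w arcs[OF xz(1) y(1)] by blast
    qed
  qed
qed

text \<open>
  The index of the path vertex below which a vertex hangs; a path vertex is its own foot.
\<close>

fun foot :: "nat \<Rightarrow> cat_vertex \<Rightarrow> nat" where
  "foot l (Path i) = i"
| "foot l (Pendent j k) = l + 1 - j"

fun height :: "cat_vertex \<Rightarrow> nat" where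
  "height (Path i) = 0"
| "height (Pendent j k) = 1"

definition cat_dist :: "nat \<Rightarrow> cat_vertex \<Rightarrow> cat_vertex \<Rightarrow> nat" where
  "cat_dist l x y = (if x = y then 0 else gap (foot l x) (foot l y) + height x + height y)"

lemma cat_dist_Path: "cat_dist l x (Path i) = gap (foot l x) i + height x"
  by (cases x) (auto simp: cat_dist_def gap_def)

lemma cat_dist_Path': "cat_dist l (Path i) x = gap i (foot l x) + height x"
  by (cases x) (auto simp: cat_dist_def gap_def)

text \<open>
  The parameters that occur as eccentric sequences of trees.
\<close>

locale balanced_caterpillar =
  fixes r l :: nat and m :: "nat \<Rightarrow> nat"
  assumes r: "0 < r" "r \<le> l" "l \<le> Suc r"
    and m: "\<And>j. \<lbrakk>2 \<le> j; j \<le> l\<rbrakk> \<Longrightarrow> 2 \<le> m j"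
begin

abbreviation "G \<equiv> ecc_caterpillar r l m"
abbreviation "V \<equiv> pverts G"

lemma Path_in_V: "Path i \<in> V \<longleftrightarrow> i \<le> r + l - 1"
  by (auto simp: ecc_caterpillar_def Let_def)

lemma Pendent_in_V: "Pendent j k \<in> V \<longleftrightarrow> 2 \<le> j \<and> j \<le> l \<and> k < m j - 2"
  by (auto simp: ecc_caterpillar_def Let_def)

lemmas in_V = Path_in_V Pendent_in_V

lemma pair_graph_G: "pair_graph G"
  using r by (intro pair_graph_ecc_caterpillar)

lemma arc_iff: "\<lbrakk>x \<in> V; y \<in> V\<rbrakk> \<Longrightarrow> (x, y) \<in> parcs G \<longleftrightarrow> cat_dist l x y = 1"
  using r by (cases x; cases y)
    (auto simp: in_V ecc_caterpillar_def Let_def cat_dist_def gap_def max_def min_def)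

lemma tree_metric_cat_dist: "tree_metric V (cat_dist l)"
proof
  show "finite V"
    using pair_graph_G by (simp add: pair_graph_def pair_digraph_def pair_fin_digraph_def pair_fin_digraph_axioms_def)
  show "cat_dist l x y = 0 \<longleftrightarrow> x = y" if "x \<in> V" "y \<in> V" for x y
    by (cases x; cases y) (auto simp: cat_dist_def gap_def max_def min_def)
  show "cat_dist l x y = cat_dist l y x" for x y by (simp add: cat_dist_def gap_commute)
  show "\<exists>z\<in>V. cat_dist l x z = 1 \<and> cat_dist l x y = Suc (cat_dist l z y)"
    if xy: "x \<in> V" "y \<in> V" "x \<noteq> y" for x y
  proof (cases x)
    case (Pendent j k)
    have "Path (l + 1 - j) \<in> V" "cat_dist l x (Path (l + 1 - j)) = 1"
      using Pendent xy r by (auto simp: in_V cat_dist_Path gap_def)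
    moreover have "cat_dist l x y = Suc (cat_dist l (Path (l + 1 - j)) y)"
      using Pendent xy by (cases y) (auto simp: cat_dist_def gap_def)
    ultimately show ?thesis by blast
  next
    case (Path i)
    consider "i < foot l y" | "foot l y < i" | "foot l y = i" by linarith
    then show ?thesis
    proof cases
      case 1
      have "foot l y \<le> r + l - 1" using xy r by (cases y) (auto simp: in_V)
      then have "Path (Suc i) \<in> V" using 1 by (simp add: in_V)
      moreover have "cat_dist l x (Path (Suc i)) = 1" "cat_dist l x y = Suc (cat_dist l (Path (Suc i)) y)"
        using Path 1 by (cases y; force simp: cat_dist_def gap_def)+
      ultimately show ?thesis by blast
    next
      case 2
      have "Path (i - 1) \<in> V" using 2 Path xy by (auto simp: in_V)
      moreover have "cat_dist l x (Path (i - 1)) = 1" "cat_dist l x y = Suc (cat_dist l (Path (i - 1)) y)"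
        using Path 2 by (cases y; force simp: cat_dist_def gap_def)+
      ultimately show ?thesis by blast
    next
      case 3
      then have "cat_dist l x y = 1" "cat_dist l y y = 0"
        using Path xy by (cases y; auto simp: cat_dist_def gap_def)+
      then show ?thesis using xy by fastforce
    qed
  qed
  show "z = z'"
    if "x \<in> V" "y \<in> V" "z \<in> V" "z' \<in> V" "cat_dist l x z = 1" "cat_dist l x z' = 1"
      "cat_dist l x y = Suc (cat_dist l z y)" "cat_dist l x y = Suc (cat_dist l z' y)" for x y z z'
  proof -
    have d0: "cat_dist l w y = 0 \<longleftrightarrow> w = y" for w
      by (cases w; cases y) (auto simp: cat_dist_def gap_def max_def min_def)
    have pendent: "w = Path (foot l x)" if "height x = 1" "cat_dist l x w = 1" for w
      using that by (cases x; cases w) (auto simp: cat_dist_def gap_def split: if_splits)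
    have spine: "w = y \<or> w = Path (if foot l y < foot l x then foot l x - 1 else Suc (foot l x))"
      if "height x = 0" "cat_dist l x w = 1" "cat_dist l x y = Suc (cat_dist l w y)" for w
      using that by (cases x; cases w; cases y) (auto simp: cat_dist_def gap_def max_def min_def split: if_splits)
    show ?thesis
    proof (cases "height x = 0")
      case True
      have "z = y \<longleftrightarrow> z' = y" using d0[of z] d0[of z'] that(7,8) by linarith
      then show ?thesis using spine[OF True that(5,7)] spine[OF True that(6,8)] by blast
    next
      case False
      then have "height x = 1" by (cases x) auto
      then show ?thesis using pendent[OF _ that(5)] pendent[OF _ that(6)] by simp
    qed
  qed
  show "cat_dist l x z = Suc (cat_dist l y z) \<or> cat_dist l y z = Suc (cat_dist l x z)"
    if "x \<in> V" "y \<in> V" "z \<in> V" and xy: "cat_dist l x y = 1" for x y z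
  proof -
    have pendent: "Suc (cat_dist l (Path i) z) = cat_dist l (Pendent j k) z \<or> Suc (cat_dist l (Pendent j k) z) = cat_dist l (Path i) z"
      if "foot l (Pendent j k) = i" for i j k
      using that by (auto simp: cat_dist_Path' cat_dist_def gap_def)
    have path: "cat_dist l (Path i) z = Suc (cat_dist l (Path (Suc i)) z) \<or> cat_dist l (Path (Suc i)) z = Suc (cat_dist l (Path i) z)" for i
      by (auto simp: cat_dist_Path' gap_def max_def min_def)
    consider i where "x = Path i" "y = Path (Suc i)" | i where "y = Path i" "x = Path (Suc i)"
      | j k where "x = Pendent j k" "y = Path (foot l x)" | j k where "y = Pendent j k" "x = Path (foot l y)"
      using xy by (cases x; cases y) (auto simp: cat_dist_def gap_def max_def min_def split: if_splits)
    then show ?thesis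
    proof cases
      case 1
      then show ?thesis using path by simp
    next
      case 2
      then show ?thesis using path by blast
    next
      case 3
      then show ?thesis using pendent[of j k "foot l x"] by auto
    next
      case 4
      then show ?thesis using pendent[of j k "foot l y"] by auto
    qed
  qed
qed

sublocale tree_metric V "cat_dist l" by (rule tree_metric_cat_dist)

abbreviation "a \<equiv> Path (l - 1)"
abbreviation "b \<equiv> Path l"

lemma left_side: "side a b = {x \<in> V. foot l x < l}" and right_side: "side b a = {x \<in> V. l \<le> foot l x}"
  using r by (auto simp: side_def cat_dist_Path gap_def)

lemma height_le: "x \<in> V \<Longrightarrow> height x \<le> 1 \<and> height x \<le> foot l x \<and> (l \<le> foot l x \<longrightarrow> height x = 0)"
  by (cases x) (auto simp: in_V)

text \<open>
  The path vertices with index \<open>l - 1\<close> and \<open>l\<close> form the middle edge; all pendent edges are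
  attached at indices below \<open>l\<close>, that is on the side of depth \<open>l - 1\<close>.
\<close>

lemma balanced: "balanced_edge a b (l - 1) (r - 1)"
  unfolding balanced_edge_def left_side right_side
proof (intro conjI ballI)
  show "a \<in> V" "b \<in> V" using r by (auto simp: in_V)
  show "cat_dist l a b = 1" using r by (simp add: cat_dist_Path gap_def)
  show "r - 1 \<le> l - 1" "l - 1 \<le> Suc (r - 1)" using r by auto
  show "cat_dist l x a \<le> l - 1" if "x \<in> {x \<in> V. foot l x < l}" for x
    using that height_le[of x] by (auto simp: cat_dist_Path gap_le gap_def)
  show "\<exists>x\<in>{x \<in> V. foot l x < l}. cat_dist l x a = l - 1"
    using r by (intro bexI[of _ "Path 0"]) (auto simp: in_V cat_dist_Path gap_def)
  show "cat_dist l x b \<le> r - 1" if "x \<in> {x \<in> V. l \<le> foot l x}" for x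
    using that r height_le[of x] by (cases x) (auto simp: cat_dist_Path gap_def in_V)
  show "\<exists>x\<in>{x \<in> V. l \<le> foot l x}. cat_dist l x b = r - 1"
    using r by (intro bexI[of _ "Path (r + l - 1)"]) (auto simp: in_V cat_dist_Path gap_def)
qed

lemma e_eq: "(l - 1) - (r - 1) = l - r" using r by simp

lemma depth_eq:
  assumes "x \<in> V"
  shows "depth (r - 1) x = (if foot l x < l then l - 1 - foot l x + height x else foot l x - r)"
proof (cases "foot l x < l")
  case True
  then have "depth (r - 1) x = cat_dist l x a" using depth_left[OF balanced] left_side assms by simp
  then show ?thesis using True by (auto simp: cat_dist_Path gap_def)
next
  case False
  then have "depth (r - 1) x = cat_dist l x b + (l - r)"
    using depth_right[OF balanced, of x] right_side assms e_eq by simp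
  then show ?thesis using False height_le[OF assms] r by (auto simp: cat_dist_Path gap_def)
qed

sublocale two_sided V "cat_dist l" "depth (r - 1)" "side b a" "l - 1" "l - r"
  using two_sided[OF balanced] unfolding e_eq .

lemma card_depth:
  assumes "1 \<le> i" "i \<le> l - 1"
  shows "card {x \<in> V. depth (r - 1) x = i} = m (Suc i)"
proof -
  have eq: "{x \<in> V. depth (r - 1) x = i} =
      {Path (l - 1 - i), Path (r + i)} \<union> Pendent (Suc i) ` {..<m (Suc i) - 2}" (is "?A = ?B")
  proof (intro set_eqI iffI)
    fix x assume "x \<in> ?A"
    then have x: "x \<in> V" "depth (r - 1) x = i" by auto
    show "x \<in> ?B"
    proof (cases x)
      case (Path p)
      then show ?thesis using depth_eq[OF x(1)] x assms r by (auto split: if_splits)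
    next
      case (Pendent j k)
      then have "j = Suc i" using depth_eq[OF x(1)] x assms by (auto simp: in_V split: if_splits)
      then show ?thesis using Pendent x by (auto simp: in_V)
    qed
  next
    fix x assume x: "x \<in> ?B"
    then have "x \<in> V" using assms r by (auto simp: in_V)
    then show "x \<in> ?A" using x depth_eq[of x] assms r by auto
  qed
  have card_B: "card ?B = card {Path (l - 1 - i), Path (r + i)} + card (Pendent (Suc i) ` {..<m (Suc i) - 2})"
    by (rule card_Un_disjoint) auto
  have pendents: "card (Pendent (Suc i) ` {..<m (Suc i) - 2}) = m (Suc i) - 2"
    by (subst card_image) (auto simp: inj_on_def)
  have "l - 1 - i \<noteq> r + i" using assms r by linarith
  moreover have "2 \<le> m (Suc i)" using m[of "Suc i"] assms by linarith
  ultimately show ?thesis unfolding eq card_B pendents by simp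
qed

lemma inj_right: "inj_on (depth (r - 1)) (side b a)"
proof (rule inj_onI)
  fix x y assume xy: "x \<in> side b a" "y \<in> side b a" "depth (r - 1) x = depth (r - 1) y"
  then show "x = y"
    using depth_eq[of x] depth_eq[of y] height_le[of x] height_le[of y] r right_side
    by (cases x; cases y) auto
qed

text \<open>
  Two vertices of one side are joined along the path, and each pendent edge adds one to the distance
  while it may change the difference of the levels by one.
\<close>

lemma tight: tight
  unfolding tight_def
proof (intro ballI impI)
  fix x y assume xy: "x \<in> V" "y \<in> V" "(x \<in> side b a) = (y \<in> side b a)"
  let ?g = "gap (depth (r - 1) x) (depth (r - 1) y)"
  have "cat_dist l x y \<le> ?g + 2"
  proof (cases "x = y")
    case False
    have heights: "height x \<le> 1" "height y \<le> 1" using xy height_le by blast+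
    have g: "depth (r - 1) x \<le> depth (r - 1) y + ?g" "depth (r - 1) y \<le> depth (r - 1) x + ?g"
      by (auto simp: gap_def)
    have dist: "cat_dist l x y = gap (foot l x) (foot l y) + height x + height y"
      using False by (simp add: cat_dist_def)
    have gap: "gap (foot l x) (foot l y) + foot l x = foot l y \<or> gap (foot l x) (foot l y) + foot l y = foot l x"
      by (auto simp: gap_def max_def min_def)
    show ?thesis
    proof (cases "foot l x < l")
      case True
      then have "foot l y < l" using xy right_side by auto
      then have "depth (r - 1) x + foot l x = l - 1 + height x" "depth (r - 1) y + foot l y = l - 1 + height y"
        using True depth_eq[OF xy(1)] depth_eq[OF xy(2)] by simp_all
      then show ?thesis unfolding dist using gap heights g by linarith
    next
      case False
      then have "l \<le> foot l y" using xy right_side by auto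
      then have "depth (r - 1) x + r = foot l x" "depth (r - 1) y + r = foot l y"
        using False depth_eq[OF xy(1)] depth_eq[OF xy(2)] r by simp_all
      then show ?thesis unfolding dist using gap heights g by linarith
    qed
  qed (simp add: cat_dist_def)
  then show "cat_dist l x y = ?g \<or> cat_dist l x y = ?g + 2"
    using same_side[OF xy] by linarith
qed

lemma caterpillar_shape:
  "\<exists>Trunk. caterpillar_shape V (cat_dist l) (depth (r - 1)) (side b a) (l - 1) (l - r) Trunk"
  using tight_imp_caterpillar_shape[OF balanced tight inj_right] e_eq by simp

lemma gdist_G: "\<lbrakk>x \<in> V; y \<in> V\<rbrakk> \<Longrightarrow> gdist G x y = cat_dist l x y"
  using pair_graph.gdist_eq_tree_metric[OF pair_graph_G tree_metric_cat_dist, of id] arc_iff by simp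

end

section \<open>The comparison theorem\<close>

locale ecc_tree = tree_metric V d for V :: "'v set" and d +
  fixes r l :: nat and m :: "nat \<Rightarrow> nat"
  assumes card_V: "1 < card V"
    and ecc_range: "eccentricity ` V = {r..<r + l}"
    and ecc_card: "\<And>j. \<lbrakk>2 \<le> j; j \<le> l\<rbrakk> \<Longrightarrow> card {v \<in> V. eccentricity v = r + j - 1} = m j"
begin

text \<open>
  The levels \<open>0, \<dots>, s\<close> are all inhabited, so the eccentricities fill the interval from \<open>Suc t\<close> to
  \<open>Suc t + s\<close>; comparison with the given range determines \<open>s\<close> and \<open>t\<close>.
\<close>

lemma balanced_edge_sizes:
  assumes bal: "balanced_edge a b s t"
  shows "s = l - 1 \<and> t = r - 1 \<and> 0 < r \<and> r \<le> l \<and> l \<le> Suc r"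
proof -
  interpret S: two_sided V d "depth t" "side b a" s "s - t" by (rule two_sided[OF bal])
  have "depth t ` V = {..s}"
  proof
    show "depth t ` V \<subseteq> {..s}" using S.lev_le by auto
    show "{..s} \<subseteq> depth t ` V" using S.left_ex by force
  qed
  moreover have "eccentricity ` V = (+) (Suc t) ` (depth t ` V)"
    unfolding image_image by (intro image_cong refl eccentricity_depth[OF bal])
  moreover have "(+) (Suc t) ` {..s} = {Suc t..<Suc t + Suc s}"
  proof (intro equalityI subsetI)
    fix x assume "x \<in> {Suc t..<Suc t + Suc s}"
    then show "x \<in> (+) (Suc t) ` {..s}" by (intro rev_image_eqI[of "x - Suc t"]) auto
  qed auto
  ultimately have eq: "{r..<r + l} = {Suc t..<Suc t + Suc s}" using ecc_range by simp
  then have "l = Suc s" by (metis card_atLeastLessThan add_diff_cancel_left')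
  moreover have "r = Suc t" using eq \<open>l = Suc s\<close> by (simp add: atLeastLessThan_eq_iff)
  ultimately show ?thesis using balanced_edgeD(4,5)[OF bal] by simp
qed

lemma balanced_edge_ex: "\<exists>a b. balanced_edge a b (l - 1) (r - 1)"
  using balanced_edge_exists[OF card_V] balanced_edge_sizes by metis

lemma card_depth:
  assumes bal: "balanced_edge a b (l - 1) (r - 1)" and i: "1 \<le> i" "i \<le> l - 1"
  shows "card {x \<in> V. depth (r - 1) x = i} = m (Suc i)"
proof -
  have r: "0 < r" using balanced_edge_sizes[OF bal] by simp
  have "{x \<in> V. depth (r - 1) x = i} = {x \<in> V. eccentricity x = r + Suc i - 1}"
    using eccentricity_depth[OF bal] r by auto
  then show ?thesis using ecc_card[of "Suc i"] i by simp
qed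

text \<open>
  Both sides of a middle edge reach this level.
\<close>

lemma m_ge_2: 
  assumes "2 \<le> j" "j \<le> l"
  shows "2 \<le> m j"
proof -
  obtain a b where bal: "balanced_edge a b (l - 1) (r - 1)" using balanced_edge_ex by blast
  interpret S: two_sided V d "depth (r - 1)" "side b a" "l - 1" "(l - 1) - (r - 1)" by (rule two_sided[OF bal])
  have j: "1 \<le> j - 1" "j - 1 \<le> l - 1" "(l - 1) - (r - 1) \<le> j - 1"
    using assms balanced_edge_sizes[OF bal] by auto
  have "2 \<le> S.size (j - 1)" using S.size_eq[of "j - 1"] S.left_ge_1[OF j(2)] S.right_ge_1[OF j(3,2)] by simp
  moreover have "Suc (j - 1) = j" using assms by simp
  ultimately show ?thesis using card_depth[OF bal j(1,2)] unfolding S.level_def by simp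
qed

lemma balanced_caterpillar: "balanced_caterpillar r l m"
  using balanced_edge_ex balanced_edge_sizes m_ge_2 by unfold_locales blast+

interpretation C: balanced_caterpillar r l m by (rule balanced_caterpillar)

lemma e_eq: "(l - 1) - (r - 1) = l - r" using C.r by simp

lemma two_sided_levels: "balanced_edge a b (l - 1) (r - 1) \<Longrightarrow> two_sided V d (depth (r - 1)) (side b a) (l - 1) (l - r)"
  using two_sided[of a b "l - 1" "r - 1"] e_eq by simp

lemma card_depth_eq:
  assumes bal: "balanced_edge a b (l - 1) (r - 1)"
  shows "card {x \<in> V. depth (r - 1) x = i} = card {x \<in> C.V. C.depth (r - 1) x = i}"
proof -
  interpret S: two_sided V d "depth (r - 1)" "side b a" "l - 1" "l - r" by (rule two_sided_levels[OF bal])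
  consider "i = 0" | "1 \<le> i" "i \<le> l - 1" | "l - 1 < i" by linarith
  then show ?thesis
  proof cases
    case 1
    then show ?thesis using S.size_0 C.size_0 unfolding S.level_def C.level_def by simp
  next
    case 2
    then show ?thesis using card_depth[OF bal] C.card_depth by simp
  next
    case 3
    then have "{x \<in> V. depth (r - 1) x = i} = {}" "{x \<in> C.V. C.depth (r - 1) x = i} = {}"
      using S.lev_le C.lev_le by fastforce+
    then show ?thesis by (simp only: card.empty)
  qed
qed

text \<open>
  Tree and caterpillar have equal level sizes, so they differ by the excess of the tree only.
\<close>

lemma sum_compare:
  fixes h :: "nat \<Rightarrow> real"
  assumes bal: "balanced_edge a b (l - 1) (r - 1)"
  shows "(\<Sum>x\<in>V. \<Sum>y\<in>V. h (d x y)) = (\<Sum>x\<in>C.V. \<Sum>y\<in>C.V. h (cat_dist l x y))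
    + (\<Sum>i\<le>l - 1. \<Sum>j\<le>l - 1. two_sided.excess V d (depth (r - 1)) (side b a) (l - r) h i j)"
proof -
  interpret S: two_sided V d "depth (r - 1)" "side b a" "l - 1" "l - r" by (rule two_sided_levels[OF bal])
  have "S.size = C.size" using card_depth_eq[OF bal] unfolding S.level_def C.level_def by (intro ext) simp
  then have "(\<Sum>i\<le>l - 1. \<Sum>j\<le>l - 1. profile (l - r) S.size h i j) =
      (\<Sum>i\<le>l - 1. \<Sum>j\<le>l - 1. profile (l - r) C.size h i j)" by simp
  moreover have "(\<Sum>i\<le>l - 1. \<Sum>j\<le>l - 1. C.excess h i j) = 0"
    using C.excess_0[OF C.tight C.inj_right] by simp
  ultimately show ?thesis using S.total_sum[of h] C.total_sum[of h] by linarith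
qed

lemma sum_ge_caterpillar:
  fixes h :: "nat \<Rightarrow> real"
  assumes "mono_on {1..} h"
  shows "(\<Sum>x\<in>C.V. \<Sum>y\<in>C.V. h (cat_dist l x y)) \<le> (\<Sum>x\<in>V. \<Sum>y\<in>V. h (d x y))"
proof -
  obtain a b where bal: "balanced_edge a b (l - 1) (r - 1)" using balanced_edge_ex by blast
  interpret S: two_sided V d "depth (r - 1)" "side b a" "l - 1" "l - r" by (rule two_sided_levels[OF bal])
  have "0 \<le> (\<Sum>i\<le>l - 1. \<Sum>j\<le>l - 1. S.excess h i j)"
    by (intro sum_nonneg S.excess_nonneg[OF assms]) simp_all
  then show ?thesis using sum_compare[OF bal, of h] by simp
qed

text \<open>
  The excess vanishes for every middle edge. One such edge yields the hypothesis under which a second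
  one has a path on one side, and the second one provides the caterpillar shape.
\<close>

lemma sum_eq_imp_isomorphic:
  fixes h :: "nat \<Rightarrow> real"
  assumes h: "strict_mono_on {1..} h"
    and eq: "(\<Sum>x\<in>V. \<Sum>y\<in>V. h (d x y)) = (\<Sum>x\<in>C.V. \<Sum>y\<in>C.V. h (cat_dist l x y))"
  shows "\<exists>\<phi>. bij_betw \<phi> V C.V \<and> (\<forall>x\<in>V. \<forall>y\<in>V. cat_dist l (\<phi> x) (\<phi> y) = 1 \<longleftrightarrow> d x y = 1)"
proof -
  have sum_0: "(\<Sum>i\<le>l - 1. \<Sum>j\<le>l - 1. two_sided.excess V d (depth (r - 1)) (side b a) (l - r) h i j) = 0"
    if "balanced_edge a b (l - 1) (r - 1)" for a b
    using sum_compare[OF that, of h] eq by linarith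
  obtain a b where bal: "balanced_edge a b (l - 1) (r - 1)" using balanced_edge_ex by blast
  have thin: "card {x \<in> side a b. depth (r - 1) x = i} = 1 \<or> card {x \<in> side b a. depth (r - 1) x = j} = 1"
    if ij: "(l - 1) - (r - 1) < i" "(l - 1) - (r - 1) < j" "i \<le> l - 1" "j \<le> l - 1" for i j
  proof -
    interpret S: two_sided V d "depth (r - 1)" "side b a" "l - 1" "l - r" by (rule two_sided_levels[OF bal])
    have "S.left i = 1 \<or> S.right j = 1" using S.excess_0_imp(2)[OF h sum_0[OF bal]] ij e_eq by simp
    then show ?thesis
      unfolding S.left_level_def S.right_level_def side_compl[OF balanced_edgeD(1-3)[OF bal]] by simp
  qed
  obtain a' b' where bal': "balanced_edge a' b' (l - 1) (r - 1)" and inj: "inj_on (depth (r - 1)) (side b' a')"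
    using balanced_edge_with_path_side[OF bal thin] by blast
  interpret S: two_sided V d "depth (r - 1)" "side b' a'" "l - 1" "l - r" by (rule two_sided_levels[OF bal'])
  have "S.tight" using S.excess_0_imp(1)[OF h sum_0[OF bal']] .
  then obtain Trunk where T: "caterpillar_shape V d (depth (r - 1)) (side b' a') (l - 1) (l - r) Trunk"
    using tight_imp_caterpillar_shape[OF bal' _ inj] e_eq by auto
  obtain Trunk' where C: "caterpillar_shape C.V (cat_dist l) (C.depth (r - 1)) (C.side C.b C.a) (l - 1) (l - r) Trunk'"
    using C.caterpillar_shape by blast
  show ?thesis by (rule caterpillar_shape_unique[OF T C card_depth_eq[OF bal']])
qed

end

lemma ecc_tree_gdist:
  assumes T: "simple_tree T" and card: "2 < card (pverts T)" and ecc: "has_eccentric_sequence T r l m"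
  shows "ecc_tree (pverts T) (gdist T) r l m"
proof -
  interpret pair_graph T using T by (simp add: simple_tree_def)
  interpret tree_metric "pverts T" "gdist T"
    using tree_metric_gdist T by (simp add: simple_tree_def)
  have "eccentricity = ecc T" by (simp add: fun_eq_iff eccentricity_def ecc_def)
  then show ?thesis using card ecc by unfold_locales (auto simp: has_eccentric_sequence_def)
qed

lemma gen_wiener_minus: "gen_wiener G (\<lambda>k. - g k) = - gen_wiener G g"
  by (simp add: gen_wiener_def sum_negf)

lemma gen_wiener_increasing:
  fixes g :: "nat \<Rightarrow> real"
  assumes T: "simple_tree T" and card: "2 < card (pverts T)" and ecc: "has_eccentric_sequence T r l m"
    and mono: "mono_on {1..} g"
  shows "gen_wiener (ecc_caterpillar r l m) g \<le> gen_wiener T g"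
    and "strict_mono_on {1..} g \<Longrightarrow>
      gen_wiener T g = gen_wiener (ecc_caterpillar r l m) g \<longleftrightarrow>
      digraph_iso (with_proj T) (with_proj (ecc_caterpillar r l m))"
proof -
  interpret ecc_tree "pverts T" "gdist T" r l m by (rule ecc_tree_gdist[OF T card ecc])
  interpret C: balanced_caterpillar r l m by (rule balanced_caterpillar)
  interpret G: pair_graph T using T by (simp add: simple_tree_def)
  interpret H: pair_graph C.G by (rule C.pair_graph_G)
  have conn: "connected (with_proj T)" using T by (simp add: simple_tree_def)
  let ?h = "g(0 := 0)"
  have WT: "2 * gen_wiener T g = (\<Sum>x\<in>pverts T. \<Sum>y\<in>pverts T. ?h (gdist T x y))"
    by (rule G.gen_wiener_double_sum) (rule d_0_iff)
  have "2 * gen_wiener C.G g = (\<Sum>x\<in>C.V. \<Sum>y\<in>C.V. ?h (gdist C.G x y))"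
    by (rule H.gen_wiener_double_sum) (simp add: C.gdist_G C.d_0_iff)
  also have "\<dots> = (\<Sum>x\<in>C.V. \<Sum>y\<in>C.V. ?h (cat_dist l x y))"
    by (intro sum.cong refl arg_cong[of _ _ ?h] C.gdist_G)
  finally have WC: "2 * gen_wiener C.G g = (\<Sum>x\<in>C.V. \<Sum>y\<in>C.V. ?h (cat_dist l x y))" .
  have "mono_on {1..} ?h" using mono by (auto simp: monotone_on_def)
  then show "gen_wiener C.G g \<le> gen_wiener T g"
    using sum_ge_caterpillar[of ?h] WT WC by simp
  assume strict: "strict_mono_on {1..} g"
  show "gen_wiener T g = gen_wiener C.G g \<longleftrightarrow> digraph_iso (with_proj T) (with_proj C.G)"
    unfolding digraph_iso_iff[OF G.pair_graph C.pair_graph_G]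
  proof
    assume "gen_wiener T g = gen_wiener C.G g"
    moreover have "strict_mono_on {1..} ?h" using strict by (auto simp: monotone_on_def)
    ultimately obtain \<phi> where \<phi>: "bij_betw \<phi> (pverts T) C.V"
        "\<forall>x\<in>pverts T. \<forall>y\<in>pverts T. cat_dist l (\<phi> x) (\<phi> y) = 1 \<longleftrightarrow> gdist T x y = 1"
      using sum_eq_imp_isomorphic[of ?h] WT WC by auto
    have "(\<phi> x, \<phi> y) \<in> parcs C.G \<longleftrightarrow> (x, y) \<in> parcs T" if "x \<in> pverts T" "y \<in> pverts T" for x y
      using \<phi> that C.arc_iff G.gdist_1_iff[OF conn that] bij_betwE[OF \<phi>(1)] by blast
    then show "\<exists>\<phi>. bij_betw \<phi> (pverts T) C.V \<and>
        (\<forall>x\<in>pverts T. \<forall>y\<in>pverts T. (\<phi> x, \<phi> y) \<in> parcs C.G \<longleftrightarrow> (x, y) \<in> parcs T)"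
      using \<phi>(1) by blast
  next
    assume "\<exists>\<phi>. bij_betw \<phi> (pverts T) C.V \<and>
        (\<forall>x\<in>pverts T. \<forall>y\<in>pverts T. (\<phi> x, \<phi> y) \<in> parcs C.G \<longleftrightarrow> (x, y) \<in> parcs T)"
    then obtain \<phi> where \<phi>: "bij_betw \<phi> (pverts T) C.V"
        "\<And>x y. \<lbrakk>x \<in> pverts T; y \<in> pverts T\<rbrakk> \<Longrightarrow> (\<phi> x, \<phi> y) \<in> parcs C.G \<longleftrightarrow> (x, y) \<in> parcs T" by blast
    have V: "\<phi> x \<in> C.V" if "x \<in> pverts T" for x using bij_betwE[OF \<phi>(1)] that by blast
    have "(x, y) \<in> parcs T \<longleftrightarrow> cat_dist l (\<phi> x) (\<phi> y) = 1" if "x \<in> pverts T" "y \<in> pverts T" for x y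
      using \<phi>(2)[OF that] C.arc_iff[OF V V] that by simp
    then have "gdist T x y = cat_dist l (\<phi> x) (\<phi> y)" if "x \<in> pverts T" "y \<in> pverts T" for x y
      using G.gdist_eq_tree_metric[OF C.tree_metric_cat_dist \<phi>(1)] that by blast
    then have "(\<Sum>x\<in>pverts T. \<Sum>y\<in>pverts T. ?h (gdist T x y)) =
        (\<Sum>x\<in>pverts T. \<Sum>y\<in>pverts T. ?h (cat_dist l (\<phi> x) (\<phi> y)))" by simp
    also have "\<dots> = (\<Sum>x\<in>pverts T. \<Sum>y\<in>C.V. ?h (cat_dist l (\<phi> x) y))"
      by (intro sum.cong refl sum.reindex_bij_betw[OF \<phi>(1)])
    also have "\<dots> = (\<Sum>x\<in>C.V. \<Sum>y\<in>C.V. ?h (cat_dist l x y))"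
      by (rule sum.reindex_bij_betw[OF \<phi>(1)])
    finally show "gen_wiener T g = gen_wiener C.G g" using WT WC by simp
  qed
qed

theorem theorem2:
  fixes T :: "'a pair_pre_digraph" and r l :: nat and m :: "nat \<Rightarrow> nat"
  assumes "simple_tree T" and "card (pverts T) > 2"
    and "has_eccentric_sequence T r l m"
  shows "(\<forall>g :: nat \<Rightarrow> real. (\<forall>k\<ge>1. 0 \<le> g k) \<and> mono_on {1..} g \<longrightarrow>
            gen_wiener T g \<ge> gen_wiener (ecc_caterpillar r l m) g \<and>
            (strict_mono_on {1..} g \<longrightarrow>
               (gen_wiener T g = gen_wiener (ecc_caterpillar r l m) g \<longleftrightarrow>
                digraph_iso (with_proj T) (with_proj (ecc_caterpillar r l m))))) \<and>
         (\<forall>g :: nat \<Rightarrow> real. (\<forall>k\<ge>1. 0 \<le> g k) \<and> antimono_on {1..} g \<longrightarrow>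
            gen_wiener T g \<le> gen_wiener (ecc_caterpillar r l m) g \<and>
            (strict_antimono_on {1..} g \<longrightarrow>
               (gen_wiener T g = gen_wiener (ecc_caterpillar r l m) g \<longleftrightarrow>
                digraph_iso (with_proj T) (with_proj (ecc_caterpillar r l m)))))"
proof (intro conjI allI impI; elim conjE)
  note increasing = gen_wiener_increasing[OF assms]
  fix g :: "nat \<Rightarrow> real"
  {
    assume g: "mono_on {1..} g"
    show "gen_wiener (ecc_caterpillar r l m) g \<le> gen_wiener T g" using increasing(1)[OF g] .
    assume "strict_mono_on {1..} g"
    then show "gen_wiener T g = gen_wiener (ecc_caterpillar r l m) g \<longleftrightarrow>
        digraph_iso (with_proj T) (with_proj (ecc_caterpillar r l m))"
      using increasing(2)[OF g] by blast
  next
    assume "antimono_on {1..} g"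
    then have g: "mono_on {1..} (\<lambda>k. - g k)" by (auto simp: monotone_on_def)
    show "gen_wiener T g \<le> gen_wiener (ecc_caterpillar r l m) g"
      using increasing(1)[OF g] by (simp add: gen_wiener_minus)
    assume "strict_antimono_on {1..} g"
    then have "strict_mono_on {1..} (\<lambda>k. - g k)" by (auto simp: monotone_on_def)
    then show "gen_wiener T g = gen_wiener (ecc_caterpillar r l m) g \<longleftrightarrow>
        digraph_iso (with_proj T) (with_proj (ecc_caterpillar r l m))"
      using increasing(2)[OF g] by (simp add: gen_wiener_minus)
  }
qed

end
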